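(* Let $(M,\hat{J},\hat{\theta})$ be a vertical, simply connected pseudohermitian submanifold of $H_{n}$ with CR dimension $m=n-1$. Suppose that the second fundamental form $II=0$. Then $M$ is an open subset $U$ of $H_{n-1}=\{z_{n}=0\}$ after a Heisenberg rigid motion.
   Context: $H_{n}$ is the Heisenberg group with coordinates $(z,t)$, $z_\beta=x_\beta+iy_\beta$, contact form $\Theta=dt+\sum_{\beta}(x_\beta dy_\beta-y_\beta dx_\beta)$, contact bundle $\xi=\ker\Theta$, standard CR structure $J$, Reeb field $T=\partial_t$ and Levi metric; a Heisenberg rigid motion is an element of the group $PSH(n)$ of pseudohermitian transformations of $H_n$. A pseudohermitian submanifold $(M,\hat J,\hat\theta)$ satisfies $\hat{\xi}=TM\cap\xi$, $\hat{J}=J|_{\hat{\xi}}$, $\hat{\theta}=\Theta|_{M}$. It is vertical if $T$ is tangent to $M$ everywhere (equivalently the fundamental vector field $\nu$, the unique section of $\hat\xi^\perp$ with $T+\nu\in TM$, vanishes identically). With a Darboux frame $Z_j\in\hat\xi_{1,0}$, $Z_a\in\hat\xi^\perp_{1,0}$, dual forms $\theta^\beta$ and pseudohermitian connection forms $\theta_\gamma{}^\beta$ of $H_n$, the second fundamental form is $II=\theta^{j}\otimes\theta_{j}{}^{a}\otimes Z_{a}$. *)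

theory Defs
  imports "HOL-Analysis.Analysis"
begin

text \<open>The Heisenberg group H_n, realised as C^n x R with coordinates (z,t).
  Tangent vectors at a point are elements of the same vector space.\<close>
type_synonym 'n heis = "(complex ^ 'n) \<times> real"

fun iter_dd :: "'a::real_normed_vector list \<Rightarrow> ('a \<Rightarrow> 'b::real_normed_vector) \<Rightarrow> 'a \<Rightarrow> 'b" where
  "iter_dd [] f = f"
| "iter_dd (v # vs) f = (\<lambda>x. vector_derivative (\<lambda>s::real. iter_dd vs f (x + s *\<^sub>R v)) (at 0))"

definition smooth_on :: "'a::euclidean_space set \<Rightarrow> ('a \<Rightarrow> 'b::real_normed_vector) \<Rightarrow> bool" where
  "smooth_on S f \<longleftrightarrow> open S \<and>
     (\<forall>vs v x. x \<in> S \<longrightarrow> (\<lambda>s::real. iter_dd vs f (x + s *\<^sub>R v)) differentiable (at 0)) \<and>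
     (\<forall>vs. continuous_on S (iter_dd vs f))"

definition diffeo_between :: "'a::euclidean_space set \<Rightarrow> 'a set \<Rightarrow> ('a \<Rightarrow> 'a) \<Rightarrow> bool" where
  "diffeo_between U V \<Phi> \<longleftrightarrow> smooth_on U \<Phi> \<and> open V \<and> bij_betw \<Phi> U V \<and> smooth_on V (inv_into U \<Phi>)"

definition embedded_submanifold :: "'a::euclidean_space set \<Rightarrow> nat \<Rightarrow> bool" where
  "embedded_submanifold M k \<longleftrightarrow>
     (\<forall>p\<in>M. \<exists>U V \<Phi> L. p \<in> U \<and> diffeo_between U V \<Phi> \<and> subspace L \<and> dim L = k \<and>
        \<Phi> ` (M \<inter> U) = V \<inter> L)"

definition tangent_space :: "'a::euclidean_space set \<Rightarrow> 'a \<Rightarrow> 'a set" where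
  "tangent_space M p = {v. \<exists>\<gamma> e. e > 0 \<and> \<gamma> ` {-e<..<e} \<subseteq> M \<and> \<gamma> 0 = p \<and>
                              (\<gamma> has_vector_derivative v) (at 0)}"

text \<open>Contact form Theta = dt + sum (x dy - y dx); note x dy - y dx = Im (conj z dz).\<close>
definition Theta :: "'n::finite heis \<Rightarrow> 'n heis \<Rightarrow> real" where
  "Theta p v = snd v + (\<Sum>b\<in>UNIV. Im (cnj (fst p $ b) * fst v $ b))"

definition contact :: "'n::finite heis \<Rightarrow> 'n heis set" where
  "contact p = {v. Theta p v = 0}"

definition hlift :: "'n::finite heis \<Rightarrow> complex ^ 'n \<Rightarrow> 'n heis" where
  "hlift p w = (w, - (\<Sum>b\<in>UNIV. Im (cnj (fst p $ b) * w $ b)))"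

text \<open>Standard CR structure J on xi: J(X_b) = Y_b, i.e. multiplication by i on the z-part.\<close>
definition CR_J :: "'n::finite heis \<Rightarrow> 'n heis \<Rightarrow> 'n heis" where
  "CR_J p v = hlift p (\<chi> b. \<i> * fst v $ b)"

definition Reeb :: "'n::finite heis" where
  "Reeb = (0, 1)"

text \<open>Levi metric g(X,Y) = dTheta(X, JY) on xi.\<close>
definition levi_metric :: "'n::finite heis \<Rightarrow> 'n heis \<Rightarrow> real" where
  "levi_metric v w = 2 * Re (\<Sum>b\<in>UNIV. cnj (fst v $ b) * fst w $ b)"

text \<open>Pseudohermitian connection of H_n: the standard frames Z_b and T are parallel,
  so nabla_X Y = hlift (X(z-part of Y)).\<close>
definition heis_nabla :: "'n::finite heis \<Rightarrow> 'n heis \<Rightarrow> ('n heis \<Rightarrow> 'n heis) \<Rightarrow> 'n heis" where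
  "heis_nabla p X Y = hlift p (fst (frechet_derivative Y (at p) X))"

definition pseudohermitian_transf :: "('n::finite heis \<Rightarrow> 'n heis) \<Rightarrow> bool" where
  "pseudohermitian_transf g \<longleftrightarrow> diffeo_between UNIV UNIV g \<and>
     (\<forall>p v. Theta (g p) (frechet_derivative g (at p) v) = Theta p v) \<and>
     (\<forall>p v. v \<in> contact p \<longrightarrow>
        frechet_derivative g (at p) (CR_J p v) = CR_J (g p) (frechet_derivative g (at p) v))"

definition hat_xi :: "'n::finite heis set \<Rightarrow> 'n heis \<Rightarrow> 'n heis set" where
  "hat_xi M p = tangent_space M p \<inter> contact p"

text \<open>(M, hat J, hat theta): hat xi = TM cap xi is J-invariant (so hat J = J|hat xi is defined)
  and hat theta = Theta|M is a contact form on M (nonvanishing on TM).\<close>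
definition pseudohermitian_submanifold :: "'n::finite heis set \<Rightarrow> nat \<Rightarrow> bool" where
  "pseudohermitian_submanifold M m \<longleftrightarrow> embedded_submanifold M (2 * m + 1) \<and>
     (\<forall>p\<in>M. \<not> tangent_space M p \<subseteq> contact p) \<and>
     (\<forall>p\<in>M. \<forall>v\<in>hat_xi M p. CR_J p v \<in> hat_xi M p) \<and>
     (\<forall>p\<in>M. dim (hat_xi M p) = 2 * m)"

definition vertical :: "'n::finite heis set \<Rightarrow> bool" where
  "vertical M \<longleftrightarrow> (\<forall>p\<in>M. Reeb \<in> tangent_space M p)"

text \<open>II = 0: for every smooth section Y of hat xi and X in TM, nabla_X Y has no
  component in hat xi-perp, i.e. nabla_X Y lies in hat xi (theta_j^a = 0).\<close>
definition second_fundamental_form_vanishes :: "'n::finite heis set \<Rightarrow> bool" where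
  "second_fundamental_form_vanishes M \<longleftrightarrow>
     (\<forall>W Y p X. open W \<and> smooth_on W Y \<and> (\<forall>q\<in>M \<inter> W. Y q \<in> hat_xi M q) \<and>
        p \<in> M \<inter> W \<and> X \<in> tangent_space M p \<longrightarrow>
        heis_nabla p X Y \<in> hat_xi M p)"

end

theory Submission
  imports Defs
begin

text \<open>Since \<open>M\<close> is vertical, its tangent space at \<open>q\<close> is \<open>W\<^sub>q \<times> \<real>\<close> for a complex hyperplane \<open>W\<^sub>q\<close> of
  \<open>\<complex>\<^sup>n\<close>. In an adapted chart, \<open>II = 0\<close> says that derivatives of tangential fields remain in \<open>W\<^sub>q\<close>, so
  \<open>W\<^sub>q\<close> solves a linear differential equation for which the constant family is the only solution;
  hence \<open>W\<^sub>q = W\<close> is locally constant, and constant because \<open>M\<close> is connected. Thus \<open>M\<close> lies in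
  \<open>(a + W) \<times> \<real>\<close>, where it is open by invariance of domain. Translating \<open>a\<close> to the origin and reflecting
  the unit normal of \<open>W\<close> to the \<open>k\<close>-th basis vector by a complex Householder map gives the rigid motion.\<close>

section \<open>Smooth functions\<close>

text \<open>\<open>smooth_on\<close> speaks only of iterated directional derivatives, so Frechet
  differentiability, the chain rule and the closure properties are derived before any geometry.
  Because the standard frame is parallel, the z-part of a covariant derivative is an ordinary
  derivative. Hence II = 0 becomes a statement about second derivatives of the z-part
  \<open>F\<close> of a chart parametrisation. \<open>F\<close> is not an immersion: it kills the
  Reeb direction, which is tangent because \<open>M\<close> is vertical. What survives is its
  constant rank \<open>2 * m\<close>, and the rigidity of its derivative ranges rests on that. Lying
  in a plane and being open in it are separate matters; openness comes from the equality of
  dimensions \<open>2 * m + 1\<close>. The reflection also carries a condition: a complex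
  Householder map takes one unit vector to another only if their Hermitian product is real, so the
  phase of the normal has to be chosen first.\<close>

lemma iter_dd_append: "iter_dd (vs @ ws) f = iter_dd vs (iter_dd ws f)"
  by (induction vs) auto

text \<open>Keeps \<open>iter_dd [v] f\<close> folded as the notation for the derivative of
  \<open>f\<close> along \<open>v\<close>; the simplifier would otherwise expose
  \<open>vector_derivative\<close>.\<close>

declare iter_dd.simps(2) [simp del]

lemma smooth_on_open: "smooth_on S f \<Longrightarrow> open S"
  by (simp add: smooth_on_def)

lemma smooth_on_iter_dd: "smooth_on S f \<Longrightarrow> smooth_on S (iter_dd ws f)"
  unfolding smooth_on_def by (metis iter_dd_append)

lemma smooth_on_imp_continuous_on_iter_dd: "smooth_on S f \<Longrightarrow> continuous_on S (iter_dd vs f)"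
  by (simp add: smooth_on_def)

lemma smooth_on_imp_continuous_on: "smooth_on S f \<Longrightarrow> continuous_on S f"
  using smooth_on_imp_continuous_on_iter_dd[of S f "[]"] by simp

section \<open>Directional derivatives and Frechet differentiability\<close>

lemma smooth_on_has_vector_derivative_line:
  assumes "smooth_on S f" "x \<in> S"
  shows "((\<lambda>s. f (x + s *\<^sub>R v)) has_vector_derivative iter_dd [v] f x) (at 0)"
  using assms unfolding smooth_on_def
  by (metis iter_dd.simps vector_derivative_works)

lemma smooth_on_has_vector_derivative_line_at:
  assumes "smooth_on S f" "x + t *\<^sub>R v \<in> S"
  shows "((\<lambda>s. f (x + s *\<^sub>R v)) has_vector_derivative iter_dd [v] f (x + t *\<^sub>R v)) (at t)"
proof -
  have "((\<lambda>s. f ((x + t *\<^sub>R v) + s *\<^sub>R v)) has_vector_derivative iter_dd [v] f (x + t *\<^sub>R v)) (at (t - t))"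
    using smooth_on_has_vector_derivative_line[OF assms] by simp
  moreover have "((\<lambda>s. s - t) has_vector_derivative 1) (at t)"
    by (auto intro!: derivative_eq_intros)
  ultimately have "((\<lambda>s. f ((x + t *\<^sub>R v) + s *\<^sub>R v)) \<circ> (\<lambda>s. s - t) has_vector_derivative
      1 *\<^sub>R iter_dd [v] f (x + t *\<^sub>R v)) (at t)"
    by (intro vector_diff_chain_at) auto
  then show ?thesis
    by (simp add: o_def algebra_simps)
qed

text \<open>Dropping coordinates does not increase the norm; this keeps every corner of a walk along
  the axes inside a given ball.\<close>

lemma norm_partial_sum_Basis_le:
  fixes h :: "'a::euclidean_space"
  assumes "B \<subseteq> Basis"
  shows "norm (\<Sum>b\<in>B. (h \<bullet> b) *\<^sub>R b) \<le> norm h"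
proof (rule norm_le_componentwise)
  fix i :: 'a assume i: "i \<in> Basis"
  have "(\<Sum>b\<in>B. (h \<bullet> b) *\<^sub>R b) \<bullet> i = (\<Sum>b\<in>B. if b = i then h \<bullet> b else 0)"
    unfolding inner_sum_left using assms i
    by (intro sum.cong) (auto simp: inner_Basis subset_iff)
  also have "\<dots> = (if i \<in> B then h \<bullet> i else 0)"
    using finite_subset[OF assms finite_Basis] by (simp add: sum.delta')
  finally show "\<bar>(\<Sum>b\<in>B. (h \<bullet> b) *\<^sub>R b) \<bullet> i\<bar> \<le> \<bar>h \<bullet> i\<bar>"
    by simp
qed

text \<open>Continuous partial derivatives give Frechet differentiability: walk from \<open>x\<close> to \<open>x + h\<close>
  along the coordinate axes and use the mean value inequality on each leg.\<close>

lemma smooth_on_has_derivative_Basis: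
  fixes f :: "'a::euclidean_space \<Rightarrow> 'b::real_normed_vector"
  assumes f: "smooth_on S f" and x: "x \<in> S"
  shows "(f has_derivative (\<lambda>h. \<Sum>b\<in>Basis. (h \<bullet> b) *\<^sub>R iter_dd [b] f x)) (at x)"
  unfolding has_derivative_at_alt
proof (intro conjI allI impI)
  show "bounded_linear (\<lambda>h. \<Sum>b\<in>Basis. (h \<bullet> b) *\<^sub>R iter_dd [b] f x)"
    by (intro bounded_linear_intros)
next
  fix e :: real assume e: "e > 0"
  \<comment> \<open>Adding up the errors of the legs costs a factor \<open>DIM('a)\<close>, since
    each coordinate of \<open>y - x\<close> is at most its norm.\<close>
  define e' where "e' = e / DIM('a)"
  have e': "e' > 0" using e by (simp add: e'_def)
  have ev: "\<forall>\<^sub>F y in nhds x. y \<in> S \<and> (\<forall>b\<in>Basis. dist (iter_dd [b] f y) (iter_dd [b] f x) < e')"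
  proof (intro eventually_conj eventually_ball_finite ballI)
    show "\<forall>\<^sub>F y in nhds x. y \<in> S"
      using smooth_on_open[OF f] x by (simp add: eventually_nhds_in_open)
    fix b :: 'a
    have "isCont (iter_dd [b] f) x"
      using smooth_on_imp_continuous_on_iter_dd[OF f, of "[b]"] smooth_on_open[OF f] x
      by (simp add: continuous_on_eq_continuous_at)
    then have "(iter_dd [b] f \<longlongrightarrow> iter_dd [b] f x) (nhds x)"
      by (simp only: isCont_def tendsto_at_iff_tendsto_nhds)
    then show "\<forall>\<^sub>F y in nhds x. dist (iter_dd [b] f y) (iter_dd [b] f x) < e'"
      using e' by (rule tendstoD)
  qed auto
  then obtain d where d: "d > 0" and
    D: "\<And>y. dist y x < d \<Longrightarrow> y \<in> S \<and> (\<forall>b\<in>Basis. dist (iter_dd [b] f y) (iter_dd [b] f x) < e')"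
    unfolding eventually_nhds_metric by blast
  \<comment> \<open>\<open>B\<close> is the set of axes already walked along; each induction step
    adds one leg.\<close>
  have main: "norm (f (x + (\<Sum>b\<in>B. (h \<bullet> b) *\<^sub>R b)) - f x - (\<Sum>b\<in>B. (h \<bullet> b) *\<^sub>R iter_dd [b] f x))
      \<le> e' * (\<Sum>b\<in>B. \<bar>h \<bullet> b\<bar>)"
    if h: "norm h < d" and B: "B \<subseteq> Basis" for h B
    using finite_subset[OF B finite_Basis] B
  proof (induction B rule: finite_induct)
    case empty
    then show ?case by simp
  next
    case (insert c B)
    define y where "y = x + (\<Sum>b\<in>B. (h \<bullet> b) *\<^sub>R b)"
    \<comment> \<open>A point of the leg is a convex combination of its two end points, both within
      \<open>norm h\<close> of \<open>x\<close>.\<close>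
    have in_ball: "dist (y + s *\<^sub>R c) x < d" if s: "s \<in> closed_segment 0 (h \<bullet> c)" for s
    proof -
      obtain u where u: "0 \<le> u" "u \<le> 1" "s = u * (h \<bullet> c)"
        using s by (auto simp: in_segment)
      have eq: "y + s *\<^sub>R c - x = (1 - u) *\<^sub>R (\<Sum>b\<in>B. (h \<bullet> b) *\<^sub>R b) + u *\<^sub>R (\<Sum>b\<in>insert c B. (h \<bullet> b) *\<^sub>R b)"
        using insert.hyps by (simp add: y_def u algebra_simps)
      have "norm (y + s *\<^sub>R c - x) \<le> (1 - u) * norm (\<Sum>b\<in>B. (h \<bullet> b) *\<^sub>R b) +
          u * norm (\<Sum>b\<in>insert c B. (h \<bullet> b) *\<^sub>R b)"
        unfolding eq using u(1,2) by (intro norm_triangle_mono) auto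
      also have "\<dots> \<le> (1 - u) * norm h + u * norm h"
        using u insert.prems by (intro add_mono mult_left_mono norm_partial_sum_Basis_le) auto
      also have "\<dots> = norm h" by (simp add: algebra_simps)
      finally show ?thesis using h by (simp add: dist_norm)
    qed
    let ?I = "closed_segment 0 (h \<bullet> c)"
    have "norm ((f (y + (h \<bullet> c) *\<^sub>R c) - (h \<bullet> c) *\<^sub>R iter_dd [c] f x) - (f (y + 0 *\<^sub>R c) - 0 *\<^sub>R iter_dd [c] f x))
       \<le> e' * norm ((h \<bullet> c) - 0)"
    \<comment> \<open>With the linear term subtracted, the derivative is the variation of
      \<open>iter_dd [c] f\<close> from its value at \<open>x\<close>, which is at most
      \<open>e'\<close>.\<close>
    proof (rule differentiable_bound[where S = ?I and f = "\<lambda>s. f (y + s *\<^sub>R c) - s *\<^sub>R iter_dd [c] f x"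
            and f' = "\<lambda>s h. h *\<^sub>R (iter_dd [c] f (y + s *\<^sub>R c) - iter_dd [c] f x)"])
      show "convex ?I" by simp
      fix s assume s: "s \<in> ?I"
      have "((\<lambda>s. f (y + s *\<^sub>R c) - s *\<^sub>R iter_dd [c] f x) has_vector_derivative
          iter_dd [c] f (y + s *\<^sub>R c) - 1 *\<^sub>R iter_dd [c] f x) (at s)"
        using D[OF in_ball[OF s]]
        by (intro has_vector_derivative_diff smooth_on_has_vector_derivative_line_at[OF f] derivative_eq_intros) auto
      then show "((\<lambda>s. f (y + s *\<^sub>R c) - s *\<^sub>R iter_dd [c] f x) has_derivative
          (\<lambda>h. h *\<^sub>R (iter_dd [c] f (y + s *\<^sub>R c) - iter_dd [c] f x))) (at s within ?I)"
        by (simp add: has_vector_derivative_def has_derivative_at_withinI)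
      have "norm (iter_dd [c] f (y + s *\<^sub>R c) - iter_dd [c] f x) \<le> e'"
        using D[OF in_ball[OF s]] insert.prems by (auto simp: dist_norm less_imp_le)
      then show "onorm (\<lambda>h. h *\<^sub>R (iter_dd [c] f (y + s *\<^sub>R c) - iter_dd [c] f x)) \<le> e'"
        by (intro onorm_le) (simp add: mult.commute[of e'] mult_left_mono)
    qed auto
    then have step: "norm (f (y + (h \<bullet> c) *\<^sub>R c) - f y - (h \<bullet> c) *\<^sub>R iter_dd [c] f x) \<le> e' * \<bar>h \<bullet> c\<bar>"
      by (simp add: algebra_simps)
    have "f (x + (\<Sum>b\<in>insert c B. (h \<bullet> b) *\<^sub>R b)) - f x - (\<Sum>b\<in>insert c B. (h \<bullet> b) *\<^sub>R iter_dd [b] f x)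
      = (f (y + (h \<bullet> c) *\<^sub>R c) - f y - (h \<bullet> c) *\<^sub>R iter_dd [c] f x) +
        (f y - f x - (\<Sum>b\<in>B. (h \<bullet> b) *\<^sub>R iter_dd [b] f x))"
      using insert.hyps by (simp add: y_def add_ac)
    also have "norm \<dots> \<le> e' * \<bar>h \<bullet> c\<bar> + e' * (\<Sum>b\<in>B. \<bar>h \<bullet> b\<bar>)"
      using insert by (intro norm_triangle_mono step) (simp add: y_def)
    finally show ?case
      using insert.hyps by (simp add: algebra_simps)
  qed
  have "norm (f y - f x - (\<Sum>b\<in>Basis. ((y - x) \<bullet> b) *\<^sub>R iter_dd [b] f x)) \<le> e * norm (y - x)"
    if y: "norm (y - x) < d" for y
  proof -
    have "norm (f y - f x - (\<Sum>b\<in>Basis. ((y - x) \<bullet> b) *\<^sub>R iter_dd [b] f x)) \<le> e' * (\<Sum>b\<in>Basis. \<bar>(y - x) \<bullet> b\<bar>)"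
      using main[OF y order_refl] by (simp only: euclidean_representation) simp
    also have "(\<Sum>b\<in>Basis. \<bar>(y - x) \<bullet> b\<bar>) \<le> DIM('a) * norm (y - x)"
      by (intro sum_bounded_above[where A = Basis, simplified] Basis_le_norm)
    then have "e' * (\<Sum>b\<in>Basis. \<bar>(y - x) \<bullet> b\<bar>) \<le> e' * (DIM('a) * norm (y - x))"
      using e' by (intro mult_left_mono) auto
    also have "\<dots> = e * norm (y - x)" by (simp add: e'_def)
    finally show ?thesis .
  qed
  then show "\<exists>d>0. \<forall>y. norm (y - x) < d \<longrightarrow>
      norm (f y - f x - (\<Sum>b\<in>Basis. ((y - x) \<bullet> b) *\<^sub>R iter_dd [b] f x)) \<le> e * norm (y - x)"
    using d by blast
qed

lemma has_derivative_imp_line: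
  assumes "(f has_derivative f') (at x)"
  shows "((\<lambda>s. f (x + s *\<^sub>R v)) has_vector_derivative f' v) (at 0)"
proof -
  have "((\<lambda>s. x + s *\<^sub>R v) has_derivative (\<lambda>s. s *\<^sub>R v)) (at 0)"
    by (auto intro!: derivative_eq_intros)
  moreover have "(f has_derivative f') (at (x + 0 *\<^sub>R v))"
    using assms by simp
  ultimately have "((\<lambda>s. f (x + s *\<^sub>R v)) has_derivative (\<lambda>s. f' (s *\<^sub>R v))) (at 0)"
    by (rule has_derivative_compose)
  then show ?thesis
    using linear_cmul[OF has_derivative_linear[OF assms]] by (simp add: has_vector_derivative_def)
qed

lemma iter_dd_Basis:
  assumes "smooth_on S f" and "x \<in> S"
  shows "iter_dd [v] f x = (\<Sum>b\<in>Basis. (v \<bullet> b) *\<^sub>R iter_dd [b] f x)"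
  using has_derivative_imp_line[OF smooth_on_has_derivative_Basis[OF assms]]
    smooth_on_has_vector_derivative_line[OF assms] vector_derivative_unique_at by blast

lemma smooth_on_has_derivative:
  assumes "smooth_on S f" and "x \<in> S"
  shows "(f has_derivative (\<lambda>v. iter_dd [v] f x)) (at x)"
proof -
  have "(\<lambda>v. iter_dd [v] f x) = (\<lambda>v. \<Sum>b\<in>Basis. (v \<bullet> b) *\<^sub>R iter_dd [b] f x)"
    by (rule ext) (rule iter_dd_Basis[OF assms])
  then show ?thesis using smooth_on_has_derivative_Basis[OF assms] by (simp only:)
qed

text \<open>Differentiating along single lines does not give additivity in the direction; it is
  inherited from the Frechet derivative.\<close>

lemma linear_iter_dd:
  assumes "smooth_on S f" and "x \<in> S"
  shows "linear (\<lambda>v. iter_dd [v] f x)"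
  using has_derivative_linear[OF smooth_on_has_derivative[OF assms]] .

text \<open>A class \<open>P\<close> closed under differentiation in every direction handles all
  iterated derivatives at once. They are compared with members of \<open>P\<close> on
  \<open>S\<close> only, because \<open>iter_dd\<close> is uncontrolled elsewhere.\<close>

lemma smooth_on_coinduct:
  fixes f :: "'a::euclidean_space \<Rightarrow> 'b::real_normed_vector"
  assumes "open S" and "P f"
    and cont: "\<And>f. P f \<Longrightarrow> continuous_on S f"
    and deriv: "\<And>f v. P f \<Longrightarrow>
      \<exists>g. P g \<and> (\<forall>x\<in>S. ((\<lambda>s. f (x + s *\<^sub>R v)) has_vector_derivative g x) (at 0))"
  shows "smooth_on S f"
proof -
  have line: "((\<lambda>s. h (x + s *\<^sub>R v)) has_vector_derivative g' x) (at 0)"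
    if eq: "\<forall>y\<in>S. h y = g y" and g': "\<forall>x\<in>S. ((\<lambda>s. g (x + s *\<^sub>R v)) has_vector_derivative g' x) (at 0)"
      and x: "x \<in> S" for h g g' :: "'a \<Rightarrow> 'b" and x v
  proof -
    \<comment> \<open>Openness of \<open>S\<close> makes \<open>h\<close> and \<open>g\<close> agree
      on a short piece of the line, so their derivatives at 0 coincide.\<close>
    have "((\<lambda>s::real. x + s *\<^sub>R v) \<longlongrightarrow> x + 0 *\<^sub>R v) (nhds 0)"
      by (intro tendsto_intros filterlim_ident)
    then have "\<forall>\<^sub>F s in nhds (0::real). x + s *\<^sub>R v \<in> S"
      using \<open>open S\<close> x by (simp add: topological_tendstoD)
    then have "\<forall>\<^sub>F s in nhds (0::real). h (x + s *\<^sub>R v) = g (x + s *\<^sub>R v)"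
      by eventually_elim (use eq in auto)
    then show ?thesis
      using g' x eq has_vector_derivative_cong_ev[where x = 0 and f = "\<lambda>s. h (x + s *\<^sub>R v)" and S = UNIV and g = "\<lambda>s. g (x + s *\<^sub>R v)"] by simp
  qed
  have ex: "\<exists>g. P g \<and> (\<forall>x\<in>S. iter_dd vs f x = g x)" for vs
  proof (induction vs)
    case Nil
    then show ?case using \<open>P f\<close> by auto
  next
    case (Cons v vs)
    then obtain g where g: "P g" "\<forall>x\<in>S. iter_dd vs f x = g x" by blast
    obtain g' where g': "P g'" "\<forall>x\<in>S. ((\<lambda>s. g (x + s *\<^sub>R v)) has_vector_derivative g' x) (at 0)"
      using deriv[OF g(1)] by blast
    have "iter_dd (v # vs) f x = g' x" if "x \<in> S" for x
      using line[OF g(2) g'(2) that] by (simp add: iter_dd.simps(2) vector_derivative_at)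
    then show ?case using g'(1) by blast
  qed
  show ?thesis
    unfolding smooth_on_def
  proof (intro conjI allI impI)
    fix vs v x assume x: "x \<in> S"
    obtain g where g: "P g" "\<forall>x\<in>S. iter_dd vs f x = g x" using ex by blast
    obtain g' where g': "P g'" "\<forall>x\<in>S. ((\<lambda>s. g (x + s *\<^sub>R v)) has_vector_derivative g' x) (at 0)"
      using deriv[OF g(1)] by blast
    show "(\<lambda>s. iter_dd vs f (x + s *\<^sub>R v)) differentiable at 0"
      using line[OF g(2) g'(2) x] differentiableI_vector by blast
  next
    fix vs
    obtain g where "P g" "\<forall>x\<in>S. iter_dd vs f x = g x" using ex by blast
    then show "continuous_on S (iter_dd vs f)"
      using cont continuous_on_cong by metis
  qed fact
qed

text \<open>The invariant class for composition with \<open>\<Phi>\<close>: the chain rule writes a derivative of \<open>g \<circ> \<Phi>\<close> as a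
  combination of functions \<open>(\<partial>\<^sub>b g) \<circ> \<Phi>\<close> with smooth coefficients, and the product rule preserves this form.\<close>

inductive smooth_span ::
  "'a::euclidean_space set \<Rightarrow> 'c::euclidean_space set \<Rightarrow> ('a \<Rightarrow> 'c) \<Rightarrow> ('a \<Rightarrow> 'b::real_normed_vector) \<Rightarrow> bool"
  for S V \<Phi> where
  base: "smooth_on V g \<Longrightarrow> smooth_span S V \<Phi> (\<lambda>x. g (\<Phi> x))"
| scale: "smooth_on S r \<Longrightarrow> smooth_span S V \<Phi> f \<Longrightarrow> smooth_span S V \<Phi> (\<lambda>x. r x *\<^sub>R f x)"
| add: "smooth_span S V \<Phi> f \<Longrightarrow> smooth_span S V \<Phi> g \<Longrightarrow> smooth_span S V \<Phi> (\<lambda>x. f x + g x)"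

section \<open>Closure properties of smooth maps\<close>

lemma smooth_on_affine:
  fixes l :: "'a::euclidean_space \<Rightarrow> 'b::real_normed_vector"
  assumes "open S" "linear l"
  shows "smooth_on S (\<lambda>x. c + l x)"
proof (rule smooth_on_coinduct[where P = "\<lambda>f. \<exists>c l. linear l \<and> f = (\<lambda>x. c + l x)"])
  fix f :: "'a \<Rightarrow> 'b" assume "\<exists>c l. linear l \<and> f = (\<lambda>x. c + l x)"
  then obtain c l where f: "linear l" "f = (\<lambda>x. c + l x)" by blast
  then interpret l: bounded_linear l by (simp add: linear_conv_bounded_linear)
  show "continuous_on S f"
    unfolding f by (intro continuous_intros l.continuous_on)
  fix v
  \<comment> \<open>The added 0 presents the constant derivative as an affine map with zero linear
    part, so it stays in the invariant class.\<close>
  have "\<forall>x\<in>S. ((\<lambda>s. f (x + s *\<^sub>R v)) has_vector_derivative l v + 0) (at 0)"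
    unfolding f by (auto simp: l.add l.scaleR intro!: derivative_eq_intros)
  then show "\<exists>g. (\<exists>c l. linear l \<and> g = (\<lambda>x. c + l x)) \<and>
      (\<forall>x\<in>S. ((\<lambda>s. f (x + s *\<^sub>R v)) has_vector_derivative g x) (at 0))"
    by (intro exI[of _ "\<lambda>x. l v + 0"] conjI exI[of _ "l v"] exI[of _ "\<lambda>x. 0"]) (auto simp: linear_iff)
qed (use assms in auto)

lemma smooth_on_id: "open S \<Longrightarrow> smooth_on S (\<lambda>x. x)"
  using smooth_on_affine[of S "\<lambda>x. x" 0] by (simp add: linear_iff)

lemma smooth_on_bounded_linear:
  fixes f :: "'a::euclidean_space \<Rightarrow> 'b::real_normed_vector" and l :: "'b \<Rightarrow> 'c::real_normed_vector"
  assumes "bounded_linear l" "smooth_on S f"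
  shows "smooth_on S (\<lambda>x. l (f x))"
proof (rule smooth_on_coinduct[where P = "\<lambda>h. \<exists>f. smooth_on S f \<and> h = (\<lambda>x. l (f x))"])
  interpret l: bounded_linear l by fact
  fix h assume "\<exists>f. smooth_on S f \<and> h = (\<lambda>x. l (f x))"
  then obtain f where f: "smooth_on S f" "h = (\<lambda>x. l (f x))" by blast
  show "continuous_on S h"
    unfolding f using smooth_on_imp_continuous_on[OF f(1)] by (rule l.continuous_on)
  fix v
  show "\<exists>g. (\<exists>f. smooth_on S f \<and> g = (\<lambda>x. l (f x))) \<and>
      (\<forall>x\<in>S. ((\<lambda>s. h (x + s *\<^sub>R v)) has_vector_derivative g x) (at 0))"
    unfolding f using f(1) smooth_on_iter_dd[OF f(1)]
    by (intro exI[of _ "\<lambda>x. l (iter_dd [v] f x)"] conjI exI[of _ "iter_dd [v] f"] ballI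
        l.has_vector_derivative smooth_on_has_vector_derivative_line[of S]) auto
qed (use assms smooth_on_open in auto)

lemma smooth_span_sum:
  fixes f :: "'i \<Rightarrow> 'a::euclidean_space \<Rightarrow> 'b::real_normed_vector"
  assumes "finite I" "smooth_on V (\<lambda>_. 0::'b)" "\<And>i. i \<in> I \<Longrightarrow> smooth_span S V \<Phi> (f i)"
  shows "smooth_span S V \<Phi> (\<lambda>x. \<Sum>i\<in>I. f i x)"
  using assms(1,3)
proof (induction I rule: finite_induct)
  case empty
  then show ?case using smooth_span.base[OF assms(2)] by simp
next
  case (insert i I)
  then show ?case by (simp add: smooth_span.add)
qed

lemma smooth_span_imp_smooth_on:
  fixes f :: "'a::euclidean_space \<Rightarrow> 'b::real_normed_vector" and \<Phi> :: "'a \<Rightarrow> 'c::euclidean_space"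
  assumes \<Phi>: "smooth_on S \<Phi>" and sub: "\<Phi> ` S \<subseteq> V" and "smooth_span S V \<Phi> f"
  shows "smooth_on S f"
proof (rule smooth_on_coinduct[where P = "smooth_span S V \<Phi>"])
  fix f :: "'a \<Rightarrow> 'b" assume f: "smooth_span S V \<Phi> f"
  then show "continuous_on S f"
  proof induction
    case (base g)
    then show ?case
      using sub continuous_on_compose2[OF smooth_on_imp_continuous_on smooth_on_imp_continuous_on[OF \<Phi>]] by blast
  qed (auto intro!: continuous_intros dest: smooth_on_imp_continuous_on)
  fix v
  show "\<exists>g. smooth_span S V \<Phi> g \<and> (\<forall>x\<in>S. ((\<lambda>s. f (x + s *\<^sub>R v)) has_vector_derivative g x) (at 0))"
    using f
  proof induction
    case (base g)
    let ?g' = "\<lambda>x. \<Sum>b\<in>Basis. (iter_dd [v] \<Phi> x \<bullet> b) *\<^sub>R iter_dd [b] g (\<Phi> x)"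
    have "smooth_span S V \<Phi> ?g'"
    proof (intro smooth_span_sum smooth_span.scale smooth_span.base smooth_on_iter_dd base)
      show "smooth_on V (\<lambda>_. 0::'b)"
        using smooth_on_affine[OF smooth_on_open[OF base], of "\<lambda>_. 0" 0] by (simp add: linear_iff)
      show "smooth_on S (\<lambda>x. iter_dd [v] \<Phi> x \<bullet> b)" for b
        by (intro smooth_on_bounded_linear[of "\<lambda>y. y \<bullet> b"] smooth_on_iter_dd \<Phi> bounded_linear_intros)
    qed auto
    moreover have "((\<lambda>s. g (\<Phi> (x + s *\<^sub>R v))) has_vector_derivative ?g' x) (at 0)" if x: "x \<in> S" for x
    proof -
      have "(g has_derivative (\<lambda>h. \<Sum>b\<in>Basis. (h \<bullet> b) *\<^sub>R iter_dd [b] g (\<Phi> x))) (at (\<Phi> x))"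
        using smooth_on_has_derivative_Basis[OF base] sub x by blast
      from has_derivative_imp_line[OF has_derivative_compose[OF smooth_on_has_derivative[OF \<Phi> x] this]]
      show ?thesis by simp
    qed
    ultimately show ?case by (intro exI[of _ ?g'] conjI ballI)
  next
    case (scale r f)
    then obtain g where g: "smooth_span S V \<Phi> g"
      "\<And>x. x \<in> S \<Longrightarrow> ((\<lambda>s. f (x + s *\<^sub>R v)) has_vector_derivative g x) (at 0)" by blast
    have "((\<lambda>s. r (x + s *\<^sub>R v) *\<^sub>R f (x + s *\<^sub>R v)) has_vector_derivative r x *\<^sub>R g x + iter_dd [v] r x *\<^sub>R f x) (at 0)"
      if "x \<in> S" for x
      using has_vector_derivative_scaleR[OF smooth_on_has_vector_derivative_line[OF scale.hyps(1) that, of v,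
          folded has_real_derivative_iff_has_vector_derivative] g(2)[OF that]] by simp
    then show ?case
      using scale.hyps g(1) smooth_on_iter_dd[OF scale.hyps(1)]
      by (intro exI[of _ "\<lambda>x. r x *\<^sub>R g x + iter_dd [v] r x *\<^sub>R f x"] conjI smooth_span.add smooth_span.scale) auto
  next
    case (add f g)
    then obtain f' g' where "smooth_span S V \<Phi> f'" "smooth_span S V \<Phi> g'"
      "\<forall>x\<in>S. ((\<lambda>s. f (x + s *\<^sub>R v)) has_vector_derivative f' x) (at 0)"
      "\<forall>x\<in>S. ((\<lambda>s. g (x + s *\<^sub>R v)) has_vector_derivative g' x) (at 0)" by blast
    then show ?case
      by (intro exI[of _ "\<lambda>x. f' x + g' x"] conjI smooth_span.add ballI has_vector_derivative_add) auto
  qed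
qed (use assms smooth_on_open in auto)

lemma smooth_on_compose:
  assumes "smooth_on S \<Phi>" "smooth_on V g" "\<Phi> ` S \<subseteq> V"
  shows "smooth_on S (\<lambda>x. g (\<Phi> x))"
  using smooth_span_imp_smooth_on[OF assms(1,3) smooth_span.base[OF assms(2)]] .

text \<open>With the identity for \<Phi>, the class \<open>smooth_span\<close> contains the smooth
  functions and is closed under smooth scalar factors, so products come for free.\<close>

lemma smooth_on_scaleR:
  assumes "smooth_on S r" "smooth_on S f"
  shows "smooth_on S (\<lambda>x. r x *\<^sub>R f x)"
proof (rule smooth_span_imp_smooth_on[where \<Phi> = "\<lambda>x. x" and V = S])
  show "smooth_span S S (\<lambda>x. x) (\<lambda>x. r x *\<^sub>R f x)"
    using smooth_span.base[OF assms(2), of S "\<lambda>x. x"] assms(1) by (intro smooth_span.scale) auto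
qed (use assms smooth_on_id smooth_on_open in auto)

lemma smooth_on_add:
  assumes "smooth_on S f" "smooth_on S g"
  shows "smooth_on S (\<lambda>x. f x + g x)"
proof (rule smooth_span_imp_smooth_on[where \<Phi> = "\<lambda>x. x" and V = S])
  show "smooth_span S S (\<lambda>x. x) (\<lambda>x. f x + g x)"
    using smooth_span.base[OF assms(1), of S "\<lambda>x. x"] smooth_span.base[OF assms(2), of S "\<lambda>x. x"]
    by (intro smooth_span.add) auto
qed (use assms smooth_on_id smooth_on_open in auto)

lemma smooth_on_sum:
  fixes f :: "'i \<Rightarrow> 'a::euclidean_space \<Rightarrow> 'b::real_normed_vector"
  assumes "open S" "finite I" "\<And>i. i \<in> I \<Longrightarrow> smooth_on S (f i)"
  shows "smooth_on S (\<lambda>x. \<Sum>i\<in>I. f i x)"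
  using assms(2,3)
proof (induction I rule: finite_induct)
  case empty
  then show ?case using smooth_on_affine[OF assms(1), of "\<lambda>_. 0" 0] by (simp add: linear_iff)
next
  case (insert i I)
  then show ?case by (simp add: smooth_on_add)
qed

lemma smooth_on_inner:
  fixes f g :: "'a::euclidean_space \<Rightarrow> 'b::euclidean_space"
  assumes "smooth_on S f" "smooth_on S g"
  shows "smooth_on S (\<lambda>x. f x \<bullet> g x)"
proof -
  have "smooth_on S (\<lambda>x. \<Sum>b\<in>Basis. (f x \<bullet> b) *\<^sub>R (g x \<bullet> b))"
    using assms smooth_on_open[OF assms(1)]
    by (intro smooth_on_sum smooth_on_scaleR smooth_on_bounded_linear[of "\<lambda>y. y \<bullet> _"] bounded_linear_intros) auto
  then show ?thesis by (simp add: euclidean_inner[of "f _" "g _"])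
qed

section \<open>Maps whose second derivatives are tangential\<close>

lemma norm_diff_le_of_derivative_bound:
  fixes \<phi> :: "real \<Rightarrow> 'b::real_normed_vector"
  assumes "\<And>s. 0 \<le> s \<Longrightarrow> s \<le> 1 \<Longrightarrow> (\<phi> has_vector_derivative \<phi>' s) (at s)"
    and "\<And>s. 0 \<le> s \<Longrightarrow> s \<le> 1 \<Longrightarrow> norm (\<phi>' s) \<le> c"
  shows "norm (\<phi> 1 - \<phi> 0) \<le> c"
proof -
  have "norm (\<phi> 1 - \<phi> 0) \<le> c * norm (1 - 0 :: real)"
  proof (rule differentiable_bound[where S = "{0..1}" and f' = "\<lambda>s h. h *\<^sub>R \<phi>' s"])
    fix s :: real assume s: "s \<in> {0..1}"
    show "(\<phi> has_derivative (\<lambda>h. h *\<^sub>R \<phi>' s)) (at s within {0..1})"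
      using assms(1)[of s] s by (simp add: has_vector_derivative_def has_derivative_at_withinI)
    show "onorm (\<lambda>h. h *\<^sub>R \<phi>' s) \<le> c"
      using assms(2)[of s] s by (intro onorm_le) (simp add: mult.commute[of c] mult_left_mono)
  qed auto
  then show ?thesis by simp
qed

lemma iter_dd_cong:
  assumes "open S" "\<And>y. y \<in> S \<Longrightarrow> f y = g y" "x \<in> S"
  shows "iter_dd vs f x = iter_dd vs g x"
  using assms(3)
proof (induction vs arbitrary: x)
  case Nil
  then show ?case using assms(2) by simp
next
  case (Cons v vs)
  have "((\<lambda>s::real. x + s *\<^sub>R v) \<longlongrightarrow> x + 0 *\<^sub>R v) (nhds 0)"
    by (intro tendsto_intros filterlim_ident)
  then have "\<forall>\<^sub>F s in nhds (0::real). x + s *\<^sub>R v \<in> S"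
    using \<open>open S\<close> Cons.prems by (simp add: topological_tendstoD)
  then have "\<forall>\<^sub>F s in nhds (0::real). s \<in> UNIV \<longrightarrow> iter_dd vs f (x + s *\<^sub>R v) = iter_dd vs g (x + s *\<^sub>R v)"
    by eventually_elim (use Cons.IH in auto)
  then show ?case
    by (simp add: iter_dd.simps(2) vector_derivative_cong_eq)
qed

text \<open>Bilinearity lets finitely many continuous functions control the second derivatives in
  all directions at once.\<close>

lemma iter_dd2_Basis:
  assumes f: "smooth_on S f" and x: "x \<in> S"
  shows "iter_dd [v, w] f x = (\<Sum>b\<in>Basis. (w \<bullet> b) *\<^sub>R (\<Sum>c\<in>Basis. (v \<bullet> c) *\<^sub>R iter_dd [c, b] f x))"
proof -
  have app: "iter_dd [v, w] f = iter_dd [v] (iter_dd [w] f)" for v w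
    using iter_dd_append[of "[v]" "[w]"] by simp
  have "iter_dd [v, w] f x = iter_dd [v] (\<lambda>y. \<Sum>b\<in>Basis. (w \<bullet> b) *\<^sub>R iter_dd [b] f y) x"
    unfolding app by (rule iter_dd_cong[OF smooth_on_open[OF f] iter_dd_Basis[OF f] x])
  also have "\<dots> = (\<Sum>b\<in>Basis. (w \<bullet> b) *\<^sub>R iter_dd [v, b] f x)"
  proof -
    have "((\<lambda>s. \<Sum>b\<in>Basis. (w \<bullet> b) *\<^sub>R iter_dd [b] f (x + s *\<^sub>R v)) has_vector_derivative
        (\<Sum>b\<in>Basis. (w \<bullet> b) *\<^sub>R iter_dd [v, b] f x)) (at 0)"
      unfolding app
      by (intro has_vector_derivative_sum bounded_linear.has_vector_derivative[OF bounded_linear_scaleR_right]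
          smooth_on_has_vector_derivative_line[OF smooth_on_iter_dd[OF f] x])
    then show ?thesis
      by (simp add: iter_dd.simps(2)[of v "[]"] vector_derivative_at)
  qed
  also have "\<dots> = (\<Sum>b\<in>Basis. (w \<bullet> b) *\<^sub>R (\<Sum>c\<in>Basis. (v \<bullet> c) *\<^sub>R iter_dd [c, b] f x))"
    unfolding app using iter_dd_Basis[OF smooth_on_iter_dd[OF f] x, of v] by simp
  finally show ?thesis .
qed

lemma iter_dd2_locally_bounded:
  assumes f: "smooth_on S f" and x: "x \<in> S"
  obtains K r where "K > 0" "r > 0" "ball x r \<subseteq> S"
    "\<And>y v w. y \<in> ball x r \<Longrightarrow> norm (iter_dd [v, w] f y) \<le> K * norm v * norm w"
proof -
  \<comment> \<open>The summand 1 is the variation of a second partial derivative that is allowed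
    within the ball chosen below.\<close>
  define K where "K = (\<Sum>b\<in>Basis. \<Sum>c\<in>Basis. norm (iter_dd [c, b] f x) + 1)"
  have "\<forall>\<^sub>F y in nhds x. y \<in> S \<and> (\<forall>b\<in>Basis. \<forall>c\<in>Basis. dist (iter_dd [c, b] f y) (iter_dd [c, b] f x) < 1)"
  proof (intro eventually_conj eventually_ball_finite ballI)
    show "\<forall>\<^sub>F y in nhds x. y \<in> S"
      using smooth_on_open[OF f] x by (simp add: eventually_nhds_in_open)
    fix b c
    have "isCont (iter_dd [c, b] f) x"
      using smooth_on_imp_continuous_on_iter_dd[OF f, of "[c, b]"] smooth_on_open[OF f] x
      by (simp add: continuous_on_eq_continuous_at)
    then have "(iter_dd [c, b] f \<longlongrightarrow> iter_dd [c, b] f x) (nhds x)"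
      by (simp only: isCont_def tendsto_at_iff_tendsto_nhds)
    then show "\<forall>\<^sub>F y in nhds x. dist (iter_dd [c, b] f y) (iter_dd [c, b] f x) < 1"
      by (rule tendstoD) simp
  qed auto
  then obtain r where r: "r > 0" "\<And>y. dist y x < r \<Longrightarrow>
      y \<in> S \<and> (\<forall>b\<in>Basis. \<forall>c\<in>Basis. dist (iter_dd [c, b] f y) (iter_dd [c, b] f x) < 1)"
    unfolding eventually_nhds_metric by blast
  have "norm (iter_dd [v, w] f y) \<le> (K + 1) * norm v * norm w" if y: "y \<in> ball x r" for y v w
  proof -
    have yS: "y \<in> S" and
      close: "\<And>b c. b \<in> Basis \<Longrightarrow> c \<in> Basis \<Longrightarrow> dist (iter_dd [c, b] f y) (iter_dd [c, b] f x) < 1"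
      using r(2)[of y] y by (auto simp: dist_commute)
    have "norm (iter_dd [v, w] f y) \<le>
        (\<Sum>b\<in>Basis. norm w * (\<Sum>c\<in>Basis. norm v * (norm (iter_dd [c, b] f x) + 1)))"
    proof (subst iter_dd2_Basis[OF f yS], rule sum_norm_le)
      fix b :: 'a assume b: "b \<in> Basis"
      have "norm (\<Sum>c\<in>Basis. (v \<bullet> c) *\<^sub>R iter_dd [c, b] f y) \<le>
          (\<Sum>c\<in>Basis. norm v * (norm (iter_dd [c, b] f x) + 1))"
      proof (rule sum_norm_le)
        fix c :: 'a assume c: "c \<in> Basis"
        have "norm (iter_dd [c, b] f y) \<le> norm (iter_dd [c, b] f x) + 1"
          using close[OF b c] norm_triangle_ineq2[of "iter_dd [c, b] f y" "iter_dd [c, b] f x"]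
          by (simp add: dist_norm)
        then show "norm ((v \<bullet> c) *\<^sub>R iter_dd [c, b] f y) \<le> norm v * (norm (iter_dd [c, b] f x) + 1)"
          using Basis_le_norm[OF c, of v] by (simp add: mult_mono)
      qed
      then show "norm ((w \<bullet> b) *\<^sub>R (\<Sum>c\<in>Basis. (v \<bullet> c) *\<^sub>R iter_dd [c, b] f y)) \<le>
          norm w * (\<Sum>c\<in>Basis. norm v * (norm (iter_dd [c, b] f x) + 1))"
        unfolding norm_scaleR real_norm_def using Basis_le_norm[OF b, of w] by (intro mult_mono) auto
    qed
    also have "\<dots> = K * norm v * norm w"
      by (simp add: K_def sum_distrib_left sum_distrib_right mult_ac)
    also have "\<dots> \<le> (K + 1) * norm v * norm w"
      by (simp add: algebra_simps)
    finally show ?thesis .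
  qed
  moreover have "K \<ge> 0" by (auto simp: K_def intro!: sum_nonneg)
  moreover have "ball x r \<subseteq> S" using r(2) by (auto simp: dist_commute)
  ultimately show ?thesis using that[of "K + 1" r] r(1) by simp
qed

text \<open>Replaces membership in a subspace by scalar equations \<open>n \<bullet> y = 0\<close>,
  which can be attacked by differentiation along curves.\<close>

lemma in_subspace_if_orthogonal_to_complement:
  fixes W :: "'e::euclidean_space set"
  assumes "subspace W" "\<And>n. (\<And>w. w \<in> W \<Longrightarrow> n \<bullet> w = 0) \<Longrightarrow> n \<bullet> y = 0"
  shows "y \<in> W"
proof -
  obtain a z where az: "a \<in> span W" "\<And>w. w \<in> span W \<Longrightarrow> orthogonal z w" "y = a + z"
    using orthogonal_subspace_decomp_exists by blast
  have z: "z \<bullet> w = 0" if "w \<in> W" for w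
    using az(2)[of w] that by (simp add: orthogonal_def span_base)
  have "z \<bullet> y = 0" using assms(2) z by blast
  moreover have "z \<bullet> a = 0" using az(1,2) by (simp add: orthogonal_def)
  ultimately have "z = 0" using az(3) by (simp add: inner_add_right)
  then have "y \<in> span W" using az(1,3) by simp
  then show ?thesis using assms(1) span_eq_iff by blast
qed

text \<open>Parametrise the range at \<open>u\<close> by \<open>B u\<close> over the range \<open>W\<^sub>0\<close> at \<open>u\<^sub>0\<close>;
  for \<open>n\<close> orthogonal to \<open>W\<^sub>0\<close>, the supremum \<open>h\<close> of \<open>n \<bullet> B u w\<close> over a small ball satisfies
  \<open>h \<le> h / 2\<close> by the mean value inequality, a Gronwall argument in disguise.\<close>

lemma derivative_range_locally_constant:
  fixes F :: "'a::euclidean_space \<Rightarrow> 'e::euclidean_space"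
  assumes F: "smooth_on V F" and L: "subspace L" and u0: "u0 \<in> V" "u0 \<in> L"
    and dimW: "\<And>u. u \<in> V \<inter> L \<Longrightarrow> dim ((\<lambda>l. iter_dd [l] F u) ` L) = d"
    and parallel: "\<And>u l l'. u \<in> V \<inter> L \<Longrightarrow> l \<in> L \<Longrightarrow> l' \<in> L \<Longrightarrow>
      iter_dd [l', l] F u \<in> (\<lambda>l. iter_dd [l] F u) ` L"
  obtains r where "r > 0" "ball u0 r \<subseteq> V"
    "\<And>u. u \<in> ball u0 r \<inter> L \<Longrightarrow> (\<lambda>l. iter_dd [l] F u) ` L = (\<lambda>l. iter_dd [l] F u0) ` L"
    "\<And>u. u \<in> ball u0 r \<inter> L \<Longrightarrow> F u - F u0 \<in> (\<lambda>l. iter_dd [l] F u0) ` L"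
proof -
  define W where "W u = (\<lambda>l. iter_dd [l] F u) ` L" for u
  have subW: "subspace (W u)" if "u \<in> V" for u
    unfolding W_def using linear_subspace_image[OF linear_iter_dd[OF F that] L] .
  \<comment> \<open>\<open>R\<close> lifts vectors of the initial range linearly to directions in
    \<open>L\<close>, so the fixed space \<open>W u0\<close> can serve as parameter space for the
    nearby ranges.\<close>
  obtain R where RL: "\<And>w. R w \<in> L" and linR: "linear R" and
    R: "\<And>w. w \<in> W u0 \<Longrightarrow> iter_dd [R w] F u0 = w"
    using linear_exists_right_inverse_on[OF linear_iter_dd[OF F u0(1)] L] unfolding W_def by blast
  define B where "B u w = iter_dd [R w] F u" for u w
  have linB: "linear (B u)" if "u \<in> V" for u
    using linear_compose[OF linR linear_iter_dd[OF F that]] by (simp add: B_def[abs_def] o_def)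
  obtain C where C: "C > 0" "\<And>w. norm (R w) \<le> C * norm w"
    using linear_bounded_pos[OF linR] by blast
  obtain K r0 where K: "K > 0" "r0 > 0" and r0V: "ball u0 r0 \<subseteq> V" and
    Kb: "\<And>y v w. y \<in> ball u0 r0 \<Longrightarrow> norm (iter_dd [v, w] F y) \<le> K * norm v * norm w"
    using iter_dd2_locally_bounded[OF F u0(1)] by blast
  \<comment> \<open>This radius bounds the derivative of \<open>B\<close> along segments by
    \<open>norm w / 4\<close>. Then \<open>B u\<close> distorts norms by at most a factor 2, and 2
    times 1/4 is the 1/2 that closes the estimate for \<open>h\<close>.\<close>
  define r where "r = min r0 (1 / (4 * K * C))"
  have r: "r > 0" "r \<le> r0" and KCr: "K * C * r \<le> 1/4"
  proof -
    show "r > 0" "r \<le> r0" using K C by (auto simp: r_def)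
    have "K * C * r \<le> K * C * (1 / (4 * K * C))"
      using K C by (intro mult_left_mono) (auto simp: r_def)
    then show "K * C * r \<le> 1/4" using K C by (simp add: field_simps)
  qed
  have rV: "ball u0 r \<subseteq> V" using r0V r by (meson subset_ball subset_trans)
  have seg: "u0 + s *\<^sub>R (u - u0) \<in> ball u0 r \<inter> L" if "u \<in> ball u0 r \<inter> L" "0 \<le> s" "s \<le> 1" for u s
  proof -
    have "norm (s *\<^sub>R (u - u0)) \<le> 1 * norm (u - u0)"
      using that by (simp add: mult_left_le_one_le)
    then have "u0 + s *\<^sub>R (u - u0) \<in> ball u0 r"
      using that by (simp add: dist_norm norm_minus_commute)
    then show ?thesis
      using that u0 L by (simp add: subspace_add subspace_scale subspace_diff)
  qed
  have D2: "norm (iter_dd [u - u0, R w] F y) \<le> norm w / 4" if "u \<in> ball u0 r" "y \<in> ball u0 r" for u y w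
  proof -
    have "norm (iter_dd [u - u0, R w] F y) \<le> K * norm (u - u0) * norm (R w)"
      using Kb[of y] that r by (meson subset_ball subsetD)
    also have "\<dots> \<le> K * r * (C * norm w)"
      using that K r C by (intro mult_mono) (auto simp: dist_norm norm_minus_commute)
    also have "\<dots> = (K * C * r) * norm w" by simp
    also have "\<dots> \<le> (1/4) * norm w" by (intro mult_right_mono KCr) simp
    finally show ?thesis by simp
  qed
  have app: "iter_dd [v, w] F = iter_dd [v] (iter_dd [w] F)" for v w
    using iter_dd_append[of "[v]" "[w]"] by simp
  have derB: "((\<lambda>s. B (u0 + s *\<^sub>R (u - u0)) w) has_vector_derivative
      iter_dd [u - u0, R w] F (u0 + s *\<^sub>R (u - u0))) (at s)"
    if "u \<in> ball u0 r \<inter> L" "0 \<le> s" "s \<le> 1" for u s w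
    unfolding B_def app using seg[OF that] rV
    by (intro smooth_on_has_vector_derivative_line_at[OF smooth_on_iter_dd[OF F]]) auto
  have B0: "B u0 w = w" if "w \<in> W u0" for w
    using R that by (simp add: B_def)
  have close: "norm (B u w - w) \<le> norm w / 4" if u: "u \<in> ball u0 r \<inter> L" and w: "w \<in> W u0" for u w
  proof -
    have "norm (B (u0 + 1 *\<^sub>R (u - u0)) w - B (u0 + 0 *\<^sub>R (u - u0)) w) \<le> norm w / 4"
      using seg[OF u] u by (intro norm_diff_le_of_derivative_bound[OF derB[OF u] D2]) auto
    then show ?thesis using B0[OF w] by simp
  qed
  have lower: "norm w \<le> 2 * norm (B u w)" if "u \<in> ball u0 r \<inter> L" "w \<in> W u0" for u w
    using close[OF that] norm_triangle_ineq3[of "B u w" w] norm_ge_zero[of w] by linarith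
  have upper: "norm (B u w) \<le> 2 * norm w" if "u \<in> ball u0 r \<inter> L" "w \<in> W u0" for u w
    using close[OF that] norm_triangle_ineq3[of "B u w" w] norm_ge_zero[of w] by linarith
  \<comment> \<open>\<open>lower\<close> makes \<open>B u\<close> injective on \<open>W u0\<close>;
    as all ranges have dimension \<open>d\<close>, its image fills \<open>W u\<close>.\<close>
  have rangeB: "B u ` W u0 = W u" if u: "u \<in> ball u0 r \<inter> L" for u
  proof (rule subspace_dim_equal)
    have uV: "u \<in> V" using u rV by blast
    show "subspace (B u ` W u0)"
      by (intro linear_subspace_image linB uV subW u0)
    show "subspace (W u)" by (intro subW uV)
    show "B u ` W u0 \<subseteq> W u" using RL by (auto simp: B_def W_def)
    have "inj_on (B u) (span (W u0))"
    proof -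
      have "inj_on (B u) (W u0)"
      proof (rule inj_onI)
        fix v w assume vw: "v \<in> W u0" "w \<in> W u0" "B u v = B u w"
        then have "B u (v - w) = 0" using linear_diff[OF linB[OF uV]] by simp
        moreover have "v - w \<in> W u0" using vw subW[OF u0(1)] by (simp add: subspace_diff)
        ultimately show "v = w" using lower[OF u, of "v - w"] by simp
      qed
      then show ?thesis using subW[OF u0(1)] by (simp add: span_eq_iff[THEN iffD2])
    qed
    then have "dim (B u ` W u0) = dim (W u0)"
      by (intro dim_image_eq linB uV)
    then show "dim (B u ` W u0) \<ge> dim (W u)"
      using dimW[of u] dimW[of u0] u uV u0 by (simp add: W_def)
  qed
  have orth: "n \<bullet> B u w = 0" if n: "\<And>w. w \<in> W u0 \<Longrightarrow> n \<bullet> w = 0"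
    and u: "u \<in> ball u0 r \<inter> L" and w: "w \<in> W u0" for n u w
  proof -
    define T where "T = {\<bar>n \<bullet> B u w\<bar> | u w. u \<in> ball u0 r \<inter> L \<and> w \<in> W u0 \<and> norm w \<le> 1}"
    have bdd: "bdd_above T"
    proof (rule bdd_aboveI[where M = "norm n * 2"])
      fix x assume "x \<in> T"
      then obtain u w where uw: "x = \<bar>n \<bullet> B u w\<bar>" "u \<in> ball u0 r \<inter> L" "w \<in> W u0" "norm w \<le> 1"
        by (auto simp: T_def)
      have "x \<le> norm n * norm (B u w)" unfolding uw(1) by (rule Cauchy_Schwarz_ineq2)
      also have "\<dots> \<le> norm n * 2"
        using upper[OF uw(2,3)] uw(4) by (intro mult_left_mono) auto
      finally show "x \<le> norm n * 2" .
    qed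
    define h where "h = Sup T"
    have le_h: "\<bar>n \<bullet> B u w\<bar> \<le> h" if "u \<in> ball u0 r \<inter> L" "w \<in> W u0" "norm w \<le> 1" for u w
      unfolding h_def using that by (intro cSup_upper[OF _ bdd]) (auto simp: T_def)
    have h0: "h \<ge> 0"
      using le_h[of u0 0] u0 r subspace_0[OF subW[OF u0(1)]] by force
    have le_hw: "\<bar>n \<bullet> B u w\<bar> \<le> h * norm w" if u: "u \<in> ball u0 r \<inter> L" and w: "w \<in> W u0" for u w
    proof (cases "w = 0")
      case True
      then show ?thesis using linear_0[OF linB] u rV by (simp add: subset_iff)
    next
      case False
      have uV: "u \<in> V" using u rV by blast
      have "\<bar>n \<bullet> B u ((1 / norm w) *\<^sub>R w)\<bar> \<le> h"
        using False subW[OF u0(1)] w by (intro le_h u) (auto simp: subspace_scale)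
      then show ?thesis
        using False linear_scale[OF linB[OF uV], of "1 / norm w" w] by (simp add: field_simps abs_mult)
    qed
    have half: "\<bar>n \<bullet> B u w\<bar> \<le> h / 2" if u: "u \<in> ball u0 r \<inter> L" and w: "w \<in> W u0" "norm w \<le> 1" for u w
    proof -
      have "norm (n \<bullet> B (u0 + 1 *\<^sub>R (u - u0)) w - n \<bullet> B (u0 + 0 *\<^sub>R (u - u0)) w) \<le> h / 2"
      proof (rule norm_diff_le_of_derivative_bound)
        fix s :: real assume s: "0 \<le> s" "s \<le> 1"
        let ?y = "u0 + s *\<^sub>R (u - u0)"
        let ?X = "iter_dd [u - u0, R w] F ?y"
        note y = seg[OF u s]
        show "((\<lambda>s. n \<bullet> B (u0 + s *\<^sub>R (u - u0)) w) has_vector_derivative n \<bullet> ?X) (at s)"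
          by (intro bounded_linear.has_vector_derivative[OF bounded_linear_inner_right] derB u s)
        \<comment> \<open>Here \<open>parallel\<close> enters: the second derivative is again a
          value \<open>B ?y w'\<close>, with \<open>norm w'\<close> at most 1/2, so the supremum
          \<open>h\<close> itself bounds the derivative by \<open>h / 2\<close>.\<close>
        have "?X \<in> W ?y"
          unfolding W_def using y rV u u0 L RL by (intro parallel) (auto simp: subspace_diff)
        then obtain w' where w': "w' \<in> W u0" "?X = B ?y w'"
          using rangeB[OF y] by blast
        have "norm w' \<le> 1/2"
          using lower[OF y w'(1)] D2[of u ?y w] u y w w'(2) by auto
        then have "h * norm w' \<le> h * (1/2)" using h0 by (intro mult_left_mono)
        then show "norm (n \<bullet> ?X) \<le> h / 2"
          using le_hw[OF y w'(1)] w'(2) by simp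
      qed
      \<comment> \<open>The function starts from 0 at \<open>u0\<close>, where
        \<open>B u0 w = w\<close> is orthogonal to \<open>n\<close>.\<close>
      then show ?thesis using B0[OF w(1)] n[OF w(1)] by simp
    qed
    have "h \<le> h / 2"
      unfolding h_def
    proof (rule cSup_least)
      show "T \<noteq> {}" using u subspace_0[OF subW[OF u0(1)]] by (force simp: T_def)
    qed (use half in \<open>auto simp: T_def h_def\<close>)
    then have "h = 0" using h0 by simp
    then show ?thesis using le_hw[OF u w] by simp
  qed
  have Weq: "W u = W u0" if u: "u \<in> ball u0 r \<inter> L" for u
  proof (rule subspace_dim_equal)
    show "W u \<subseteq> W u0"
    proof
      fix y assume "y \<in> W u"
      then obtain w where w: "w \<in> W u0" "y = B u w" using rangeB[OF u] by blast
      show "y \<in> W u0"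
        using orth[OF _ u w(1)] w(2)
        by (intro in_subspace_if_orthogonal_to_complement subW u0) auto
    qed
    show "dim (W u) \<ge> dim (W u0)"
      using dimW[of u] dimW[of u0] u rV u0 by (simp add: W_def subset_iff)
  qed (use u rV u0 subW in auto)
  \<comment> \<open>The velocity of \<open>F\<close> along the segment lies in the range at each
    point, which is now \<open>W u0\<close> throughout; hence the components of \<open>F\<close>
    normal to it are constant.\<close>
  have "F u - F u0 \<in> W u0" if u: "u \<in> ball u0 r \<inter> L" for u
  proof (rule in_subspace_if_orthogonal_to_complement[OF subW[OF u0(1)]])
    fix n assume n: "\<And>w. w \<in> W u0 \<Longrightarrow> n \<bullet> w = 0"
    have "norm (n \<bullet> F (u0 + 1 *\<^sub>R (u - u0)) - n \<bullet> F (u0 + 0 *\<^sub>R (u - u0))) \<le> 0"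
    proof (rule norm_diff_le_of_derivative_bound)
      fix s :: real assume s: "0 \<le> s" "s \<le> 1"
      let ?y = "u0 + s *\<^sub>R (u - u0)"
      note y = seg[OF u s]
      show "((\<lambda>s. n \<bullet> F (u0 + s *\<^sub>R (u - u0))) has_vector_derivative n \<bullet> iter_dd [u - u0] F ?y) (at s)"
        using y rV
        by (intro bounded_linear.has_vector_derivative[OF bounded_linear_inner_right]
            smooth_on_has_vector_derivative_line_at[OF F]) auto
      have "iter_dd [u - u0] F ?y \<in> W u0"
        using Weq[OF y] u u0 L by (auto simp: W_def subspace_diff)
      then show "norm (n \<bullet> iter_dd [u - u0] F ?y) \<le> 0" using n by simp
    qed
    then show "n \<bullet> (F u - F u0) = 0" by (simp add: inner_diff_right)
  qed
  then show ?thesis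
    using that[OF r(1) rV] Weq unfolding W_def by blast
qed

section \<open>Submanifolds of the Heisenberg group\<close>

lemma iter_dd_bounded_linear:
  assumes l: "bounded_linear l" and f: "smooth_on S f" and x: "x \<in> S"
  shows "iter_dd vs (\<lambda>x. l (f x)) x = l (iter_dd vs f x)"
  using x
proof (induction vs arbitrary: x)
  case Nil
  then show ?case by simp
next
  case (Cons v vs)
  have "iter_dd (v # vs) (\<lambda>x. l (f x)) x = iter_dd [v] (\<lambda>x. l (iter_dd vs f x)) x"
    using iter_dd_append[of "[v]" vs "\<lambda>x. l (f x)"]
      iter_dd_cong[OF smooth_on_open[OF f] Cons.IH Cons.prems, of "\<lambda>x. x" "[v]"] by simp
  also have "\<dots> = l (iter_dd [v] (iter_dd vs f) x)"
  proof -
    have "((\<lambda>s. l (iter_dd vs f (x + s *\<^sub>R v))) has_vector_derivative l (iter_dd [v] (iter_dd vs f) x)) (at 0)"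
      by (intro bounded_linear.has_vector_derivative[OF l]
          smooth_on_has_vector_derivative_line[OF smooth_on_iter_dd[OF f] Cons.prems])
    then show ?thesis
      by (simp add: iter_dd.simps(2)[of v "[]" "\<lambda>x. l (iter_dd vs f x)"] vector_derivative_at)
  qed
  finally show ?case
    using iter_dd_append[of "[v]" vs f] by simp
qed

section \<open>Slice charts and tangent spaces\<close>

lemma has_vector_derivative_in_subspace:
  fixes c :: "real \<Rightarrow> 'e::euclidean_space"
  assumes "(c has_vector_derivative w) (at 0)" "\<forall>\<^sub>F s in nhds 0. c s \<in> L" "subspace L"
  shows "w \<in> L"
proof (rule in_subspace_if_orthogonal_to_complement[OF assms(3)])
  fix n assume n: "\<And>v. v \<in> L \<Longrightarrow> n \<bullet> v = 0"
  have 1: "((\<lambda>s. n \<bullet> c s) has_vector_derivative n \<bullet> w) (at 0)"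
    by (intro bounded_linear.has_vector_derivative[OF bounded_linear_inner_right] assms)
  have ev: "\<forall>\<^sub>F s in nhds 0. s \<in> UNIV \<longrightarrow> n \<bullet> c s = 0"
    using assms(2) by eventually_elim (use n in auto)
  then have "n \<bullet> c 0 = 0" using eventually_nhds_x_imp_x by fastforce
  then have "((\<lambda>s. n \<bullet> c s) has_vector_derivative 0) (at 0)"
    using has_vector_derivative_cong_ev[OF ev] by simp
  then show "n \<bullet> w = 0" using 1 vector_derivative_unique_at by blast
qed

text \<open>The slice chart of \<open>embedded_submanifold\<close> with its inverse as a map of its
  own: \<Psi> restricted to \<open>V \<inter> L\<close> is a smooth parametrisation of
  \<open>M \<inter> U\<close>.\<close>

locale adapted_chart =
  fixes M :: "'a::euclidean_space set" and U V :: "'a set" and \<Phi> \<Psi> :: "'a \<Rightarrow> 'a" and L :: "'a set"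
  assumes smooth_\<Phi>: "smooth_on U \<Phi>" and smooth_\<Psi>: "smooth_on V \<Psi>"
    and \<Phi>V: "\<And>q. q \<in> U \<Longrightarrow> \<Phi> q \<in> V" and \<Psi>U: "\<And>u. u \<in> V \<Longrightarrow> \<Psi> u \<in> U"
    and \<Psi>\<Phi>: "\<And>q. q \<in> U \<Longrightarrow> \<Psi> (\<Phi> q) = q" and \<Phi>\<Psi>: "\<And>u. u \<in> V \<Longrightarrow> \<Phi> (\<Psi> u) = u"
    and subspace_L: "subspace L" and straight: "\<Phi> ` (M \<inter> U) = V \<inter> L"
begin

lemma \<Phi>_in_L: "q \<in> M \<Longrightarrow> q \<in> U \<Longrightarrow> \<Phi> q \<in> L"
  using straight by blast

lemma \<Psi>_in_M:
  assumes "u \<in> V" "u \<in> L"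
  shows "\<Psi> u \<in> M"
proof -
  obtain q where "q \<in> M \<inter> U" "u = \<Phi> q" using straight assms by blast
  then show ?thesis using \<Psi>\<Phi> by simp
qed

lemma D\<Psi>_D\<Phi>:
  assumes "u \<in> V"
  shows "iter_dd [iter_dd [v] \<Phi> (\<Psi> u)] \<Psi> u = v"
proof -
  note qU = \<Psi>U[OF assms]
  have "((\<lambda>q. \<Psi> (\<Phi> q)) has_derivative (\<lambda>v. iter_dd [iter_dd [v] \<Phi> (\<Psi> u)] \<Psi> u)) (at (\<Psi> u))"
    using has_derivative_compose[OF smooth_on_has_derivative[OF smooth_\<Phi> qU], of \<Psi>]
      smooth_on_has_derivative[OF smooth_\<Psi> assms] \<Phi>\<Psi>[OF assms] by simp
  moreover have "((\<lambda>q. \<Psi> (\<Phi> q)) has_derivative (\<lambda>v. v)) (at (\<Psi> u))"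
    by (rule has_derivative_transform_within_open[OF has_derivative_ident smooth_on_open[OF smooth_\<Phi>] qU])
      (simp add: \<Psi>\<Phi>)
  ultimately show ?thesis
    using has_derivative_unique by metis
qed

text \<open>Velocities of curves do not visibly form a subspace. Curves in \<open>M\<close> pushed
  through \<Phi> have velocities in \<open>L\<close>, and straight lines in \<open>L\<close> yield
  curves in \<open>M\<close>; this identifies the velocities with a linear image.\<close>

lemma tangent_space_eq:
  assumes u: "u \<in> V" "u \<in> L"
  shows "tangent_space M (\<Psi> u) = (\<lambda>l. iter_dd [l] \<Psi> u) ` L"
proof (intro set_eqI iffI)
  fix v assume "v \<in> tangent_space M (\<Psi> u)"
  then obtain \<gamma> e where e: "e > 0" "\<gamma> ` {-e<..<e} \<subseteq> M" and \<gamma>: "\<gamma> 0 = \<Psi> u" "(\<gamma> has_vector_derivative v) (at 0)"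
    by (auto simp: tangent_space_def)
  have "(\<Phi> has_derivative (\<lambda>v. iter_dd [v] \<Phi> (\<Psi> u))) (at (\<gamma> 0))"
    using smooth_on_has_derivative[OF smooth_\<Phi> \<Psi>U[OF u(1)]] \<gamma>(1) by simp
  from has_derivative_compose[OF \<gamma>(2)[unfolded has_vector_derivative_def] this]
  have der: "((\<lambda>s. \<Phi> (\<gamma> s)) has_vector_derivative iter_dd [v] \<Phi> (\<Psi> u)) (at 0)"
    using linear_scale[OF linear_iter_dd[OF smooth_\<Phi> \<Psi>U[OF u(1)]]]
    by (simp add: has_vector_derivative_def)
  have "isCont \<gamma> 0" using \<gamma>(2) has_vector_derivative_continuous by blast
  then have "(\<gamma> \<longlongrightarrow> \<gamma> 0) (nhds 0)"
    by (simp only: isCont_def tendsto_at_iff_tendsto_nhds)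
  then have "\<forall>\<^sub>F s in nhds 0. \<gamma> s \<in> U"
    using smooth_on_open[OF smooth_\<Phi>] \<Psi>U[OF u(1)] \<gamma>(1) by (simp add: topological_tendstoD)
  moreover have "\<forall>\<^sub>F s in nhds 0. s \<in> {-e<..<e}"
    using e by (intro eventually_nhds_in_open) auto
  ultimately have "\<forall>\<^sub>F s in nhds 0. \<Phi> (\<gamma> s) \<in> L"
    by eventually_elim (use e \<Phi>_in_L in blast)
  then have "iter_dd [v] \<Phi> (\<Psi> u) \<in> L"
    by (rule has_vector_derivative_in_subspace[OF der _ subspace_L])
  then show "v \<in> (\<lambda>l. iter_dd [l] \<Psi> u) ` L"
    using D\<Psi>_D\<Phi>[OF u(1), of v] by force
next
  fix v assume "v \<in> (\<lambda>l. iter_dd [l] \<Psi> u) ` L"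
  then obtain l where l: "l \<in> L" "v = iter_dd [l] \<Psi> u" by blast
  have "((\<lambda>s::real. u + s *\<^sub>R l) \<longlongrightarrow> u + 0 *\<^sub>R l) (nhds 0)"
    by (intro tendsto_intros filterlim_ident)
  then have "\<forall>\<^sub>F s in nhds (0::real). u + s *\<^sub>R l \<in> V"
    using smooth_on_open[OF smooth_\<Psi>] u by (simp add: topological_tendstoD)
  then obtain e where e: "e > 0" "\<And>s::real. dist s 0 < e \<Longrightarrow> u + s *\<^sub>R l \<in> V"
    unfolding eventually_nhds_metric by blast
  have "(\<lambda>s. \<Psi> (u + s *\<^sub>R l)) ` {-e<..<e} \<subseteq> M"
    using e(2) l(1) u subspace_L by (auto intro!: \<Psi>_in_M simp: subspace_add subspace_scale)
  then show "v \<in> tangent_space M (\<Psi> u)"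
    using smooth_on_has_vector_derivative_line[OF smooth_\<Psi> u(1), of l] e(1) l(2)
    unfolding tangent_space_def by (intro CollectI exI[of _ "\<lambda>s. \<Psi> (u + s *\<^sub>R l)"] exI[of _ e]) auto
qed

lemma subspace_tangent_space:
  assumes "q \<in> M" "q \<in> U"
  shows "subspace (tangent_space M q)"
  using tangent_space_eq[OF \<Phi>V \<Phi>_in_L, of q] assms \<Psi>\<Phi>
    linear_subspace_image[OF linear_iter_dd[OF smooth_\<Psi> \<Phi>V] subspace_L, of q] by simp

end

lemma embedded_submanifold_chart:
  assumes "embedded_submanifold M d" "p \<in> M"
  obtains U V \<Phi> \<Psi> L where "adapted_chart M U V \<Phi> \<Psi> L" "p \<in> U" "dim L = d"
proof -
  obtain U V \<Phi> L where c: "p \<in> U" "diffeo_between U V \<Phi>" "subspace L" "dim L = d" "\<Phi> ` (M \<inter> U) = V \<inter> L"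
    using assms unfolding embedded_submanifold_def by blast
  have bij: "bij_betw \<Phi> U V" using c(2) by (simp add: diffeo_between_def)
  have "adapted_chart M U V \<Phi> (inv_into U \<Phi>) L"
  proof
    show "\<Phi> q \<in> V" if "q \<in> U" for q using bij that by (auto simp: bij_betw_def)
    show "inv_into U \<Phi> u \<in> U" if "u \<in> V" for u using bij that by (auto simp: bij_betw_def inv_into_into)
    show "inv_into U \<Phi> (\<Phi> q) = q" if "q \<in> U" for q using bij that by (auto simp: bij_betw_def)
    show "\<Phi> (inv_into U \<Phi> u) = u" if "u \<in> V" for u using bij that by (auto simp: bij_betw_def f_inv_into_f)
  qed (use c in \<open>auto simp: diffeo_between_def\<close>)
  then show ?thesis using that c by blast
qed

section \<open>Contact planes, horizontal lifts and z-projections\<close>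

lemma linear_cmult_vec: "linear (\<lambda>z :: complex ^ 'n. \<chi> b. c * z $ b)"
  by (simp add: linear_iff vec_eq_iff algebra_simps)

text \<open>As a real inner product, the sum in \<open>Theta\<close> and \<open>hlift\<close>
  inherits smoothness and linearity.\<close>

lemma Im_hermitian_eq_inner:
  fixes z w :: "complex ^ 'n::finite"
  shows "(\<Sum>b\<in>UNIV. Im (cnj (z $ b) * w $ b)) = (\<chi> b. \<i> * z $ b) \<bullet> w"
  unfolding inner_vec_def by (intro sum.cong) (auto simp: inner_complex_def algebra_simps)

lemma fst_hlift [simp]: "fst (hlift p w) = w"
  by (simp add: hlift_def)

lemma hlift_eq: "hlift q w = (w, 0) + (- ((\<chi> b. \<i> * fst q $ b) \<bullet> w)) *\<^sub>R (0, 1)"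
  by (simp add: hlift_def Im_hermitian_eq_inner[symmetric])

lemma smooth_on_hlift:
  fixes w :: "'n::finite heis \<Rightarrow> complex ^ 'n"
  assumes "smooth_on S w"
  shows "smooth_on S (\<lambda>q. hlift q (w q))"
  unfolding hlift_eq
proof (intro smooth_on_add smooth_on_scaleR)
  note S = smooth_on_open[OF assms]
  show "smooth_on S (\<lambda>q. (w q, 0::real))"
    by (rule smooth_on_bounded_linear[of "\<lambda>w. (w, 0::real)"])
      (intro bounded_linear_Pair bounded_linear_ident bounded_linear_zero assms)+
  have "linear (\<lambda>q::'n heis. \<chi> b. \<i> * fst q $ b)"
    using linear_compose[OF linear_fst linear_cmult_vec[of \<i>]] by (simp add: o_def)
  then have "smooth_on S (\<lambda>q::'n heis. \<chi> b. \<i> * fst q $ b)"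
    using smooth_on_affine[OF S, of _ 0] by fastforce
  then have "smooth_on S (\<lambda>q. (\<chi> b. \<i> * fst q $ b) \<bullet> w q)"
    by (intro smooth_on_inner assms)
  then show "smooth_on S (\<lambda>q. - ((\<chi> b. \<i> * fst q $ b) \<bullet> w q))"
    by (intro smooth_on_bounded_linear[of uminus] bounded_linear_minus bounded_linear_ident)
  show "smooth_on S (\<lambda>q. (0, 1) :: 'n heis)"
    using smooth_on_affine[OF S, of "\<lambda>_. 0" "(0, 1) :: 'n heis"] by (simp add: linear_iff)
qed

lemma Theta_hlift [simp]: "Theta q (hlift q w) = 0"
  by (simp add: Theta_def hlift_def)

text \<open>Taking the z-part and lifting it again is the projection to the contact plane along
  \<open>Reeb\<close>; on a vertical \<open>M\<close> it therefore preserves tangency.\<close>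

lemma hlift_fst_eq: "hlift q (fst v) = v - Theta q v *\<^sub>R Reeb"
  by (simp add: hlift_def Theta_def Reeb_def prod_eq_iff)

lemma hlift_in_hat_xi:
  assumes "subspace (tangent_space M q)" "Reeb \<in> tangent_space M q" "v \<in> tangent_space M q"
  shows "hlift q (fst v) \<in> hat_xi M q"
  unfolding hat_xi_def contact_def using assms
  by (auto simp: hlift_fst_eq[of q v] intro!: subspace_diff subspace_scale)
    (metis Theta_hlift hlift_fst_eq)

lemma fst_hat_xi:
  assumes "subspace (tangent_space M q)" "Reeb \<in> tangent_space M q"
  shows "fst ` hat_xi M q = fst ` tangent_space M q"
proof
  show "fst ` tangent_space M q \<subseteq> fst ` hat_xi M q"
    using hlift_in_hat_xi[OF assms] by (metis (no_types, lifting) fst_hlift image_iff image_subsetI)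
qed (auto simp: hat_xi_def)

text \<open>A contact vector is the lift of its z-part, so \<open>fst\<close> is injective on
  \<open>hat_xi\<close>, while \<open>Reeb\<close> adds nothing to the image.\<close>

lemma dim_fst_tangent_space:
  assumes "subspace (tangent_space M q)" "Reeb \<in> tangent_space M q"
  shows "dim (fst ` tangent_space M q) = dim (hat_xi M q)"
proof -
  have eq: "v = hlift q (fst v)" if "Theta q v = 0" for v
    using that by (simp add: hlift_fst_eq)
  have lin: "linear (Theta q)"
    unfolding Theta_def Im_hermitian_eq_inner by (simp add: linear_iff inner_add_right algebra_simps)
  have "subspace (contact q)"
    using linear_subspace_vimage[OF lin subspace_single_0] by (simp add: contact_def vimage_def)
  then have "subspace (hat_xi M q)"
    unfolding hat_xi_def by (rule subspace_inter[OF assms(1)])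
  then have "span (hat_xi M q) = hat_xi M q" by (simp only: span_eq_iff)
  moreover have "inj_on fst (hat_xi M q)"
    by (rule inj_onI) (metis (mono_tags, lifting) IntD2 contact_def eq hat_xi_def mem_Collect_eq)
  ultimately have "inj_on fst (span (hat_xi M q))" by (simp only:)
  then show ?thesis
    using dim_image_eq[OF linear_fst, of "hat_xi M q"] fst_hat_xi[OF assms] by simp
qed

text \<open>The sections fed into the vanishing of the second fundamental form are the horizontal parts of
  the coordinate fields of an adapted chart.\<close>

lemma second_derivative_parallel:
  fixes M :: "'n::finite heis set"
  assumes "adapted_chart M U V \<Phi> \<Psi> L" and vert: "vertical M" and II: "second_fundamental_form_vanishes M"
    and u: "u \<in> V" "u \<in> L" and l: "l \<in> L" "l' \<in> L"
  shows "fst (iter_dd [l', l] \<Psi> u) \<in> fst ` tangent_space M (\<Psi> u)"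
proof -
  interpret adapted_chart M U V \<Phi> \<Psi> L by fact
  define w where "w q = fst (iter_dd [l] \<Psi> (\<Phi> q))" for q
  define Y where "Y q = hlift q (w q)" for q
  let ?X = "iter_dd [l'] \<Psi> u"
  have smooth_Y: "smooth_on U Y"
    unfolding Y_def w_def
    by (intro smooth_on_hlift smooth_on_bounded_linear[OF bounded_linear_fst]
        smooth_on_compose[OF smooth_\<Phi> smooth_on_iter_dd[OF smooth_\<Psi>]]) (use \<Phi>V in blast)
  have Y_hat: "Y q \<in> hat_xi M q" if q: "q \<in> M \<inter> U" for q
  proof -
    have "iter_dd [l] \<Psi> (\<Phi> q) \<in> tangent_space M q"
      using tangent_space_eq[OF \<Phi>V \<Phi>_in_L, of q] q \<Psi>\<Phi> l by auto
    then show ?thesis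
      unfolding Y_def w_def using q vert
      by (intro hlift_in_hat_xi subspace_tangent_space) (auto simp: vertical_def)
  qed
  have pMU: "\<Psi> u \<in> M \<inter> U" using \<Psi>_in_M[OF u] \<Psi>U[OF u(1)] by simp
  have X: "?X \<in> tangent_space M (\<Psi> u)"
    using tangent_space_eq[OF u] l by blast
  have "heis_nabla (\<Psi> u) ?X Y \<in> hat_xi M (\<Psi> u)"
    using II smooth_Y Y_hat pMU X smooth_on_open[OF smooth_Y]
    unfolding second_fundamental_form_vanishes_def by blast
  then have nabla: "fst (frechet_derivative Y (at (\<Psi> u)) ?X) \<in> fst ` tangent_space M (\<Psi> u)"
    unfolding heis_nabla_def hat_xi_def by (metis IntD1 fst_hlift imageI)
  have derY: "(Y has_derivative frechet_derivative Y (at (\<Psi> u))) (at (\<Psi> u))"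
    using smooth_on_has_derivative[OF smooth_Y \<Psi>U[OF u(1)]] frechet_derivative_works differentiable_def by blast
  \<comment> \<open>The connection differentiates only the z-part; along the image of the line in
    direction \<open>l'\<close> this is a directional derivative in the chart.\<close>
  have "((\<lambda>s. fst (Y (\<Psi> (u + s *\<^sub>R l')))) has_vector_derivative
      fst (frechet_derivative Y (at (\<Psi> u)) ?X)) (at 0)"
    using has_derivative_imp_line[OF has_derivative_compose[OF smooth_on_has_derivative[OF smooth_\<Psi> u(1)] derY]]
    by (intro bounded_linear.has_vector_derivative[OF bounded_linear_fst])
  then have "fst (frechet_derivative Y (at (\<Psi> u)) ?X) = iter_dd [l'] (\<lambda>y. fst (Y (\<Psi> y))) u"
    by (simp add: iter_dd.simps(2)[of l' "[]" "\<lambda>y. fst (Y (\<Psi> y))"] vector_derivative_at)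
  \<comment> \<open>\<Phi> undoes \<Psi> on \<open>V\<close>, so in the chart the section has as
    z-part the z-part of the first derivative of \<Psi> along \<open>l\<close>.\<close>
  also have "\<dots> = iter_dd [l'] (\<lambda>y. fst (iter_dd [l] \<Psi> y)) u"
    by (rule iter_dd_cong[OF smooth_on_open[OF smooth_\<Psi>] _ u(1)]) (simp add: Y_def w_def \<Phi>\<Psi>)
  also have "\<dots> = fst (iter_dd [l'] (iter_dd [l] \<Psi>) u)"
    by (rule iter_dd_bounded_linear[OF bounded_linear_fst smooth_on_iter_dd[OF smooth_\<Psi>] u(1)])
  also have "iter_dd [l'] (iter_dd [l] \<Psi>) = iter_dd [l', l] \<Psi>"
    using iter_dd_append[of "[l']" "[l]" \<Psi>] by simp
  finally show ?thesis using nabla by simp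
qed

text \<open>Two neighbourhoods serve two directions: \<open>N\<close> localises points of
  \<open>M\<close> and places them in the affine plane, \<open>G\<close> localises points of the
  plane and places them in \<open>M\<close>.\<close>

lemma vertical_flat_local_structure:
  fixes M :: "'n::finite heis set"
  assumes psh: "pseudohermitian_submanifold M m" and vert: "vertical M"
    and II: "second_fundamental_form_vanishes M" and p: "p \<in> M"
  obtains N G where "open N" "p \<in> N" "open G" "p \<in> G"
    "\<And>q. q \<in> M \<inter> N \<Longrightarrow> fst ` tangent_space M q = fst ` tangent_space M p"
    "\<And>q. q \<in> M \<inter> N \<Longrightarrow> fst q - fst p \<in> fst ` tangent_space M p"
    "\<And>q. q \<in> G \<Longrightarrow> fst q - fst p \<in> fst ` tangent_space M p \<Longrightarrow> q \<in> M"
proof -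
  have "embedded_submanifold M (2 * m + 1)" using psh by (simp add: pseudohermitian_submanifold_def)
  then obtain U V \<Phi> \<Psi> L where "adapted_chart M U V \<Phi> \<Psi> L" and pU: "p \<in> U" and dimL: "dim L = 2 * m + 1"
    using embedded_submanifold_chart[OF _ p] by blast
  then interpret adapted_chart M U V \<Phi> \<Psi> L by simp
  define F where "F u = fst (\<Psi> u)" for u
  have smooth_F: "smooth_on V F"
    unfolding F_def by (rule smooth_on_bounded_linear[OF bounded_linear_fst smooth_\<Psi>])
  have iter_F: "iter_dd vs F u = fst (iter_dd vs \<Psi> u)" if "u \<in> V" for vs u
    unfolding F_def by (rule iter_dd_bounded_linear[OF bounded_linear_fst smooth_\<Psi> that])
  define u0 where "u0 = \<Phi> p"
  have u0: "u0 \<in> V" "u0 \<in> L" "\<Psi> u0 = p"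
    using \<Phi>V[OF pU] \<Phi>_in_L[OF p pU] \<Psi>\<Phi>[OF pU] by (auto simp: u0_def)
  have range_F: "(\<lambda>l. iter_dd [l] F u) ` L = fst ` tangent_space M (\<Psi> u)" if "u \<in> V" "u \<in> L" for u
    unfolding tangent_space_eq[OF that] by (simp add: iter_F[OF that(1)] image_image)
  have subT: "subspace (tangent_space M q)" if "q \<in> M \<inter> U" for q
    using subspace_tangent_space that by blast
  have dimW: "dim (fst ` tangent_space M q) = 2 * m" if "q \<in> M \<inter> U" for q
    using dim_fst_tangent_space[OF subT[OF that]] that vert psh
    by (auto simp: vertical_def pseudohermitian_submanifold_def)
  have \<Psi>MU: "\<Psi> u \<in> M \<inter> U" if "u \<in> V \<inter> L" for u
    using that \<Psi>_in_M \<Psi>U by blast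
  let ?W = "fst ` tangent_space M p"
  obtain r where r: "r > 0" "ball u0 r \<subseteq> V"
    "\<And>u. u \<in> ball u0 r \<inter> L \<Longrightarrow> (\<lambda>l. iter_dd [l] F u) ` L = (\<lambda>l. iter_dd [l] F u0) ` L"
    "\<And>u. u \<in> ball u0 r \<inter> L \<Longrightarrow> F u - F u0 \<in> (\<lambda>l. iter_dd [l] F u0) ` L"
  proof (rule derivative_range_locally_constant[OF smooth_F subspace_L u0(1,2), where d = "2 * m"])
    show "dim ((\<lambda>l. iter_dd [l] F u) ` L) = 2 * m" if "u \<in> V \<inter> L" for u
      using range_F[of u] that dimW[OF \<Psi>MU[OF that]] by simp
    show "iter_dd [l', l] F u \<in> (\<lambda>l. iter_dd [l] F u) ` L" if "u \<in> V \<inter> L" "l \<in> L" "l' \<in> L" for u l l'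
      using second_derivative_parallel[OF adapted_chart_axioms vert II _ _ that(2,3), of u] that(1)
        range_F[of u] iter_F[of u] by simp
  qed blast
  define N where "N = U \<inter> \<Phi> -` ball u0 r"
  have "open N"
    unfolding N_def using smooth_on_imp_continuous_on[OF smooth_\<Phi>] smooth_on_open[OF smooth_\<Phi>]
    by (intro continuous_open_preimage) auto
  have subW: "subspace ?W" using subT p pU by (intro linear_subspace_image linear_fst) auto
  have step: "fst ` tangent_space M q = ?W \<and> fst q - fst p \<in> ?W" if q: "q \<in> M \<inter> N" for q
  proof -
    have q': "\<Phi> q \<in> ball u0 r \<inter> L" "\<Phi> q \<in> V" "\<Psi> (\<Phi> q) = q"
      using q \<Phi>_in_L \<Phi>V \<Psi>\<Phi> by (auto simp: N_def)
    then show ?thesis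
      using r(3,4)[OF q'(1)] range_F[of "\<Phi> q"] range_F[OF u0(1,2)] u0(3) by (simp add: F_def)
  qed
  \<comment> \<open>\<open>L\<close> and \<open>?W \<times> UNIV\<close> both have dimension
    \<open>2 * m + 1\<close>, so invariance of domain makes this injective map open; the shift by
    \<open>p\<close> moves its values into a linear subspace.\<close>
  have "openin (top_of_set (?W \<times> UNIV)) ((\<lambda>u. \<Psi> u - p) ` (ball u0 r \<inter> L))"
  proof (rule invariance_of_domain_subspaces[of L])
    show "openin (top_of_set L) (ball u0 r \<inter> L)" by (metis inf_commute open_ball openin_open_Int)
    show "subspace (?W \<times> (UNIV::real set))" using subW by (simp add: subspace_Times)
    have "dim (?W \<times> (UNIV::real set)) = dim ?W + dim (UNIV::real set)"
      by (intro dim_Times subW subspace_UNIV)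
    then show "dim (?W \<times> (UNIV::real set)) \<le> dim L"
      using dimW[of p] p pU dimL by simp
    show "continuous_on (ball u0 r \<inter> L) (\<lambda>u. \<Psi> u - p)"
      using r(2) by (intro continuous_intros continuous_on_subset[OF smooth_on_imp_continuous_on[OF smooth_\<Psi>]]) auto
    show "(\<lambda>u. \<Psi> u - p) \<in> ball u0 r \<inter> L \<rightarrow> ?W \<times> UNIV"
      using r(4) range_F[OF u0(1,2)] u0(3) by (auto simp: F_def mem_Times_iff)
    show "inj_on (\<lambda>u. \<Psi> u - p) (ball u0 r \<inter> L)"
      using r(2) \<Phi>\<Psi> by (intro inj_onI) (metis IntD1 diff_add_cancel subsetD)
  qed (rule subspace_L)
  then obtain T where T: "open T" "(\<lambda>u. \<Psi> u - p) ` (ball u0 r \<inter> L) = (?W \<times> UNIV) \<inter> T"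
    unfolding openin_open by blast
  define G where "G = (\<lambda>q. q - p) -` T"
  have "open G" unfolding G_def by (intro open_vimage T continuous_intros)
  moreover have "p \<in> G"
  proof -
    have "\<Psi> u0 - p \<in> (\<lambda>u. \<Psi> u - p) ` (ball u0 r \<inter> L)"
      using u0(2) r(1) by (intro imageI) simp
    then have "\<Psi> u0 - p \<in> T" unfolding T(2) by blast
    then show ?thesis using u0(3) by (simp add: G_def)
  qed
  moreover have "q \<in> M" if "q \<in> G" "fst q - fst p \<in> ?W" for q
  proof -
    have "q - p \<in> (\<lambda>u. \<Psi> u - p) ` (ball u0 r \<inter> L)"
      unfolding T(2) using that by (simp add: G_def mem_Times_iff)
    then obtain u where "u \<in> ball u0 r \<inter> L" "q - p = \<Psi> u - p" by (rule imageE)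
    then show ?thesis using \<Psi>_in_M[of u] r(2) by auto
  qed
  moreover have "p \<in> N" using pU r(1) by (simp add: N_def u0_def)
  ultimately show ?thesis using that[of N G] \<open>open N\<close> step by blast
qed

lemma vertical_flat_global_structure:
  fixes M :: "'n::finite heis set"
  assumes psh: "pseudohermitian_submanifold M m" and vert: "vertical M"
    and II: "second_fundamental_form_vanishes M" and conn: "connected M" and p: "p \<in> M"
  obtains W where "subspace W" "dim W = 2 * m" "\<And>w. w \<in> W \<Longrightarrow> (\<chi> b. \<i> * w $ b) \<in> W"
    "openin (top_of_set {q. fst q - fst p \<in> W}) M"
proof -
  define W where "W q = fst ` tangent_space M q" for q
  have subT: "subspace (tangent_space M q)" if "q \<in> M" for q
    using embedded_submanifold_chart[of M "2 * m + 1", OF _ that] adapted_chart.subspace_tangent_space[OF _ that]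
      psh unfolding pseudohermitian_submanifold_def by metis
  have subW: "subspace (W q)" if "q \<in> M" for q
    unfolding W_def by (intro linear_subspace_image linear_fst subT that)
  have reeb: "Reeb \<in> tangent_space M p" using vert p by (simp add: vertical_def)
  \<comment> \<open>Recording the tangent directions together with the whole affine plane through
    \<open>q\<close> lets one locally constant function yield both claims of
    \<open>glob\<close>.\<close>
  define f where "f q = (W q, {z. z - fst q \<in> W q})" for q
  have const: "f p = f q" if "q \<in> M" for q
  proof (rule connected_local_const[OF conn p that], intro ballI)
    fix a assume a: "a \<in> M"
    obtain N where N: "open N" "a \<in> N" "\<And>q. q \<in> M \<inter> N \<Longrightarrow> W q = W a" "\<And>q. q \<in> M \<inter> N \<Longrightarrow> fst q - fst a \<in> W a"
      using vertical_flat_local_structure[OF psh vert II a] unfolding W_def by metis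
    have "f a = f q" if q: "q \<in> M \<inter> N" for q
    proof -
      have "z - fst q \<in> W a \<longleftrightarrow> z - fst a \<in> W a" for z
        using subspace_add[OF subW[OF a] N(4)[OF q], of "z - fst q"]
          subspace_diff[OF subW[OF a] _ N(4)[OF q], of "z - fst a"] by (auto simp: algebra_simps)
      then show ?thesis using N(3)[OF q] by (simp add: f_def)
    qed
    then show "\<forall>\<^sub>F b in at a within M. f a = f b"
      unfolding eventually_at_topological using N(1,2) by blast
  qed
  have glob: "W q = W p" "fst q - fst p \<in> W p" if q: "q \<in> M" for q
  proof -
    show "W q = W p" using const[OF q] by (simp add: f_def)
    have "fst q \<in> {z. z - fst q \<in> W q}" using subspace_0[OF subW[OF q]] by simp
    also have "{z. z - fst q \<in> W q} = {z. z - fst p \<in> W p}" using const[OF q] unfolding f_def by blast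
    finally show "fst q - fst p \<in> W p" by simp
  qed
  have "openin (top_of_set {q. fst q - fst p \<in> W p}) M"
  proof (subst openin_subopen, intro ballI)
    fix a assume a: "a \<in> M"
    obtain G where G: "open G" "a \<in> G" "\<And>q. q \<in> G \<Longrightarrow> fst q - fst a \<in> W a \<Longrightarrow> q \<in> M"
      using vertical_flat_local_structure[OF psh vert II a] unfolding W_def by metis
    let ?A = "{q. fst q - fst p \<in> W p}"
    have "openin (top_of_set ?A) (?A \<inter> G)" using G(1) by (simp add: openin_open_Int)
    moreover have "?A \<inter> G \<subseteq> M"
    proof
      fix q assume q: "q \<in> ?A \<inter> G"
      then have "(fst q - fst p) - (fst a - fst p) \<in> W p"
        by (intro subspace_diff[OF subW[OF p] _ glob(2)[OF a]]) simp
      then show "q \<in> M" using G(3)[of q] q glob(1)[OF a] by simp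
    qed
    moreover have "a \<in> ?A \<inter> G" using glob(2)[OF a] G(2) by simp
    ultimately show "\<exists>T. openin (top_of_set ?A) T \<and> a \<in> T \<and> T \<subseteq> M" by blast
  qed
  moreover have "(\<chi> b. \<i> * w $ b) \<in> W p" if "w \<in> W p" for w
  proof -
    \<comment> \<open>Every element of \<open>W p\<close> is the z-part of a horizontal tangent
      vector, on which \<open>CR_J\<close> acts as multiplication by \<i>.\<close>
    have "w \<in> fst ` hat_xi M p"
      using that fst_hat_xi[OF subT[OF p] reeb] unfolding W_def by (simp only:)
    then obtain v where v: "v \<in> hat_xi M p" "w = fst v" by (elim imageE)
    then have "CR_J p v \<in> hat_xi M p" using psh p by (simp add: pseudohermitian_submanifold_def)
    then have "fst (CR_J p v) \<in> W p" unfolding W_def hat_xi_def by blast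
    then show ?thesis by (simp add: CR_J_def v(2))
  qed
  moreover have "dim (W p) = 2 * m"
    using dim_fst_tangent_space[OF subT[OF p] reeb] psh p
    by (simp add: W_def pseudohermitian_submanifold_def)
  ultimately show ?thesis using that subW[OF p] by blast
qed

section \<open>Rigid motions\<close>

text \<open>Conjugate linear in the first argument: the real part is the Euclidean inner product,
  the imaginary part is the horizontal term of \<open>Theta\<close>.\<close>

definition herm :: "complex ^ 'n \<Rightarrow> complex ^ 'n \<Rightarrow> complex" where
  "herm z w = (\<Sum>b\<in>UNIV. cnj (z $ b) * w $ b)"

lemma herm_diff_left: "herm (x - y) z = herm x z - herm y z"
  and herm_diff_right: "herm z (x - y) = herm z x - herm z y"
  and herm_add_right: "herm z (x + y) = herm z x + herm z y"
  and herm_smult_left: "herm (c *s x) z = cnj c * herm x z"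
  and herm_smult_right: "herm x (c *s z) = c * herm x z"
  by (simp_all add: herm_def algebra_simps sum_subtractf sum.distrib sum_distrib_left)

lemma herm_scaleR_right: "herm x (r *\<^sub>R z) = r *\<^sub>R herm x z"
  by (simp add: herm_def scaleR_sum_right)

lemma herm_zero_right: "herm x 0 = 0"
  by (simp add: herm_def)

lemma herm_axis: "herm (axis k 1) z = z $ k"
proof -
  have "herm (axis k 1) z = (\<Sum>b\<in>UNIV. if b = k then z $ b else 0)"
    unfolding herm_def axis_def by (intro sum.cong) auto
  then show ?thesis by simp
qed

lemma cnj_herm: "cnj (herm z w) = herm w z"
  by (simp add: herm_def mult.commute)

lemma herm_conv_inner: "herm z w = Complex (z \<bullet> w) ((\<i> *s z) \<bullet> w)"
proof -
  have "Re (herm z w) = z \<bullet> w"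
    unfolding herm_def inner_vec_def Re_sum by (intro sum.cong) (auto simp: inner_complex_def)
  moreover have "Im (herm z w) = (\<i> *s z) \<bullet> w"
    unfolding herm_def inner_vec_def Im_sum by (intro sum.cong) (auto simp: inner_complex_def)
  ultimately show ?thesis by (simp add: complex_eq_iff)
qed

lemma herm_self: "herm z z = of_real (z \<bullet> z)"
proof -
  have "Im (herm z z) = 0" using cnj_herm[of z z] by (metis complex_cnj_zero_iff Reals_cnj_iff complex_is_Real_iff)
  then show ?thesis by (simp add: herm_conv_inner complex_eq_iff)
qed

lemma Theta_conv_herm: "Theta p v = snd v + Im (herm (fst p) (fst v))"
  by (simp add: Theta_def herm_def)

text \<open>For \<open>v = 0\<close> the division by zero makes the reflection the identity.\<close>

definition householder :: "complex ^ 'n \<Rightarrow> complex ^ 'n \<Rightarrow> complex ^ 'n" where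
  "householder v z = z - (of_real (2 / (v \<bullet> v)) * herm v z) *s v"

text \<open>Separates off the zero vector, where the coefficient takes its default value 0;
  otherwise this normalisation replaces computations with the quotient.\<close>

lemma householder_cases:
  obtains "v = 0" | "of_real (2 / (v \<bullet> v)) * herm v v = 2"
  by (cases "v = 0") (auto simp: herm_self)

lemma householder_zero [simp]: "householder 0 z = z"
  by (simp add: householder_def)

lemma linear_householder: "linear (householder v)"
proof -
  obtain c where "householder v = (\<lambda>z. z - (c * herm v z) *s v)"
    using householder_def[of v] by blast
  then show ?thesis
    by (simp add: linear_iff herm_add_right herm_scaleR_right vec_eq_iff algebra_simps)
qed

lemma householder_smult: "householder v (c *s z) = c *s householder v z"
  by (simp add: householder_def herm_smult_right vec_eq_iff algebra_simps)

text \<open>The component along \<open>v\<close> is multiplied by 1 - 2; the involution and the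
  unitarity below both rest on this sign.\<close>

lemma herm_householder_self: "herm v (householder v z) = - herm v z"
proof (cases rule: householder_cases[of v])
  case 2
  have "herm v (householder v z) = herm v z - herm v z * (of_real (2 / (v \<bullet> v)) * herm v v)"
    by (simp add: householder_def herm_diff_right herm_smult_right)
  then show ?thesis by (simp only: 2) simp
qed (simp add: herm_def)

lemma householder_involution: "householder v (householder v z) = z"
  unfolding householder_def[of v "householder v z"] herm_householder_self
  by (simp add: householder_def vec_eq_iff)

lemma herm_householder: "herm (householder v z) (householder v w) = herm z w"
proof (cases rule: householder_cases[of v])
  case 2
  let ?c = "of_real (2 / (v \<bullet> v)) :: complex"
  have "herm (householder v z) (householder v w) =
      herm z (householder v w) - cnj (?c * herm v z) * herm v (householder v w)"
    by (simp only: householder_def[of v z] herm_diff_left herm_smult_left)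
  also have "\<dots> = herm z w - ?c * herm v w * herm z v + cnj (?c * herm v z) * herm v w"
    by (simp only: herm_householder_self) (simp add: householder_def[of v w] herm_diff_right herm_smult_right)
  also have "cnj (?c * herm v z) = ?c * herm z v" by (simp add: cnj_herm)
  finally show ?thesis by (simp add: algebra_simps)
qed simp

text \<open>Equal norms and a real product make \<open>herm (\<nu> - e) (\<nu> - e)\<close> twice
  \<open>herm (\<nu> - e) \<nu>\<close>, so the reflection subtracts exactly
  \<open>\<nu> - e\<close> from \<nu>. For a nonreal product the coefficient would differ from
  1.\<close>

lemma householder_swap:
  assumes "\<nu> \<bullet> \<nu> = e \<bullet> e" "herm \<nu> e \<in> \<real>"
  shows "householder (\<nu> - e) \<nu> = e"
proof (cases rule: householder_cases[of "\<nu> - e"])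
  case 1
  then show ?thesis by simp
next
  case 2
  have sym: "herm e \<nu> = herm \<nu> e" using assms(2) cnj_herm[of \<nu> e] by (simp add: Reals_cnj_iff)
  have "herm \<nu> \<nu> = herm e e" using assms(1) by (simp add: herm_self)
  then have "herm (\<nu> - e) (\<nu> - e) = 2 * herm (\<nu> - e) \<nu>"
    by (simp add: herm_diff_left herm_diff_right sym)
  then have "2 * (of_real (2 / ((\<nu> - e) \<bullet> (\<nu> - e))) * herm (\<nu> - e) \<nu>) = 2 * 1"
    using 2 by (simp only: mult.left_commute[of 2] mult_1_right)
  then have "of_real (2 / ((\<nu> - e) \<bullet> (\<nu> - e))) * herm (\<nu> - e) \<nu> = 1"
    by (rule mult_left_cancel[THEN iffD1, rotated]) simp
  then show ?thesis
    by (simp only: householder_def) simp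
qed

text \<open>Invariance under \<i> promotes a real normal vector to a Hermitian one, and comparing
  real dimensions shows that its kernel is no larger than \<open>W\<close>. The reality of the
  \<open>k\<close>-th entry prepares \<open>householder_swap\<close>.\<close>

lemma complex_hyperplane_normal:
  fixes W :: "(complex ^ 'n) set"
  assumes W: "subspace W" and dimW: "dim W = 2 * (CARD('n) - 1)"
    and J: "\<And>w. w \<in> W \<Longrightarrow> \<i> *s w \<in> W"
  obtains \<nu> where "\<nu> \<bullet> \<nu> = 1" "\<nu> $ k \<in> \<real>" "W = {w. herm \<nu> w = 0}"
proof -
  let ?P = "\<lambda>A :: (complex ^ 'n) set. {y \<in> UNIV. \<forall>x\<in>A. orthogonal x y}"
  \<comment> \<open>Ensures that the truncated subtraction in \<open>CARD('n) - 1\<close> is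
    exact.\<close>
  have card: "CARD('n) \<ge> 1" by (simp add: Suc_leI)
  have dim_UNIV: "dim (UNIV :: (complex ^ 'n) set) = 2 * CARD('n)" by simp
  have "dim (?P W) + dim W = dim (UNIV :: (complex ^ 'n) set)"
    by (intro dim_subspace_orthogonal_to_vectors W subspace_UNIV) simp
  then have "dim (?P W) = 2" using card unfolding dim_UNIV dimW by arith
  then have "\<not> ?P W \<subseteq> {0}" unfolding dim_eq_0[symmetric] by simp
  then obtain \<mu> where \<mu>: "\<mu> \<noteq> 0" "\<And>w. w \<in> W \<Longrightarrow> w \<bullet> \<mu> = 0" by (auto simp: orthogonal_def)
  have herm\<mu>: "herm \<mu> w = 0" if "w \<in> W" for w
  proof -
    have "herm \<mu> (\<i> *s w) = \<i> * herm \<mu> w" by (simp add: herm_smult_right)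
    moreover have "Re (herm \<mu> (\<i> *s w)) = 0" "Re (herm \<mu> w) = 0"
      using \<mu>(2)[OF that] \<mu>(2)[OF J[OF that]] by (simp_all add: herm_conv_inner inner_commute)
    ultimately show ?thesis by (simp add: complex_eq_iff)
  qed
  \<comment> \<open>The numerator is the phase that makes the \<open>k\<close>-th entry real, or 1
    if that entry vanishes; the denominator normalises the length.\<close>
  define c where "c = (if \<mu> $ k = 0 then 1 else cnj (\<mu> $ k) / of_real (norm (\<mu> $ k))) / of_real (norm \<mu>)"
  have c: "norm c = 1 / norm \<mu>" by (simp add: c_def norm_divide)
  define \<nu> where "\<nu> = c *s \<mu>"
  have herm\<nu>: "herm \<nu> w = 0" if "w \<in> W" for w
    using herm\<mu>[OF that] by (simp add: \<nu>_def herm_smult_left)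
  have "complex_of_real (\<nu> \<bullet> \<nu>) = of_real ((norm c)\<^sup>2 * (\<mu> \<bullet> \<mu>))"
    unfolding herm_self[symmetric] of_real_mult complex_norm_square
    by (simp add: \<nu>_def herm_smult_left herm_smult_right)
  then have \<nu>1: "\<nu> \<bullet> \<nu> = 1"
    using c \<mu>(1) unfolding of_real_eq_iff by (simp add: power2_norm_eq_inner[symmetric] field_simps)
  have \<nu>k: "\<nu> $ k \<in> \<real>"
  proof (cases "\<mu> $ k = 0")
    case False
    have "\<nu> $ k = (\<mu> $ k * cnj (\<mu> $ k)) / (of_real (norm (\<mu> $ k)) * of_real (norm \<mu>))"
      using False by (simp add: \<nu>_def c_def)
    also have "\<dots> = of_real ((norm (\<mu> $ k))\<^sup>2 / (norm (\<mu> $ k) * norm \<mu>))"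
      by (simp only: complex_norm_square[symmetric]) simp
    finally show ?thesis by simp
  qed (simp add: \<nu>_def)
  have orth: "\<nu> \<bullet> (\<i> *s \<nu>) = 0"
    using herm_self[of \<nu>] herm_conv_inner[of \<nu> \<nu>] by (simp add: complex_eq_iff inner_commute)
  have i\<nu>: "\<i> *s \<nu> \<noteq> 0" using \<nu>1 by auto
  \<comment> \<open>\<nu> and \<open>\<i> *s \<nu>\<close> span a real plane; the Hermitian kernel
    lies in its orthogonal complement, whose dimension is that of \<open>W\<close>.\<close>
  define S where "S = span {\<nu>, \<i> *s \<nu>}"
  have ne: "\<nu> \<noteq> \<i> *s \<nu>" using orth \<nu>1 by auto
  have "independent {\<nu>, \<i> *s \<nu>}"
    using orth i\<nu> \<nu>1 ne by (intro pairwise_orthogonal_independent)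
      (auto simp: pairwise_def orthogonal_def inner_commute)
  then have "dim S = 2" unfolding S_def using ne by (simp add: dim_span dim_eq_card_independent)
  moreover have "dim (?P S) + dim S = dim (UNIV :: (complex ^ 'n) set)"
    by (intro dim_subspace_orthogonal_to_vectors subspace_UNIV) (auto simp: S_def)
  ultimately have dimP: "dim (?P S) = 2 * (CARD('n) - 1)" using card unfolding dim_UNIV by arith
  have ker: "herm \<nu> w = 0 \<longleftrightarrow> \<nu> \<bullet> w = 0 \<and> (\<i> *s \<nu>) \<bullet> w = 0" for w
    by (simp add: herm_conv_inner complex_eq_iff)
  have sub: "subspace {w. herm \<nu> w = 0}"
    by (auto simp: subspace_def herm_add_right herm_scaleR_right herm_zero_right)
  have "{w. herm \<nu> w = 0} \<subseteq> ?P S"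
  proof (clarsimp, unfold S_def)
    fix w x assume w: "herm \<nu> w = 0" and x: "x \<in> span {\<nu>, \<i> *s \<nu>}"
    have "orthogonal w x"
      by (rule orthogonal_to_span[OF x]) (use w in \<open>auto simp: ker orthogonal_def inner_commute\<close>)
    then show "orthogonal x w" by (simp add: orthogonal_commute)
  qed
  then have "dim {w. herm \<nu> w = 0} \<le> dim (?P S)" by (rule dim_subset)
  then have "dim {w. herm \<nu> w = 0} \<le> dim W" unfolding dimP dimW .
  then have "W = {w. herm \<nu> w = 0}"
    using herm\<nu> by (intro subspace_dim_equal W sub) auto
  then show ?thesis using that \<nu>1 \<nu>k by blast
qed

text \<open>A left translation followed by a unitary map. Since
  \<open>Im \<langle>z - a, dz\<rangle> + d (Im \<langle>a, z\<rangle>) = Im \<langle>z, dz\<rangle>\<close>, the shear in \<open>t\<close> restores the contact form.\<close>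

definition rigid_motion :: "(complex ^ 'n \<Rightarrow> complex ^ 'n) \<Rightarrow> complex ^ 'n \<Rightarrow> 'n::finite heis \<Rightarrow> 'n heis" where
  "rigid_motion H a p = (H (fst p - a), snd p + Im (herm a (fst p)))"

lemma rigid_motion_pseudohermitian:
  fixes H :: "complex ^ 'n::finite \<Rightarrow> complex ^ 'n"
  assumes lin: "linear H" and smult: "\<And>c z. H (c *s z) = c *s H z"
    and unitary: "\<And>z w. herm (H z) (H w) = herm z w" and inv: "\<And>z. H (H z) = z"
  shows "pseudohermitian_transf (rigid_motion H a)" "bij (rigid_motion H a)"
    "continuous_on UNIV (inv (rigid_motion H a))"
proof -
  let ?g = "rigid_motion H a"
  define l where "l v = (H (fst v), snd v + Im (herm a (fst v)))" for v :: "'n heis"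
  have lin_l: "linear l"
    using linear_add[OF lin] linear_scale[OF lin]
    by (simp add: linear_iff l_def herm_add_right herm_scaleR_right algebra_simps)
  have g_eq: "?g = (\<lambda>p. (- H a, 0) + l p)"
    using linear_diff[OF lin] by (auto simp: fun_eq_iff rigid_motion_def l_def)
  \<comment> \<open>The explicit inverse: \<open>H\<close> is its own inverse, so apply
    \<open>H\<close>, translate back and undo the shear at the resulting point.\<close>
  define g' where "g' p = (a + H (fst p), snd p - Im (herm a (a + H (fst p))))" for p :: "'n heis"
  define l' where "l' v = (H (fst v), snd v - Im (herm a (H (fst v))))" for v :: "'n heis"
  have lin_l': "linear l'"
    using linear_add[OF lin] linear_scale[OF lin]
    by (simp add: linear_iff l'_def herm_add_right herm_scaleR_right algebra_simps)
  have g'_eq: "g' = (\<lambda>p. (a, - Im (herm a a)) + l' p)"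
    by (auto simp: fun_eq_iff g'_def l'_def herm_add_right)
  have gg': "?g (g' p) = p" and g'g: "g' (?g p) = p" for p
    by (simp_all add: rigid_motion_def g'_def inv)
  then have inv_g: "inv ?g = g'" by (intro inv_equality)
  show bij: "bij ?g" using gg' g'g by (metis bijI')
  have smooth_g': "smooth_on UNIV g'"
    unfolding g'_eq by (intro smooth_on_affine open_UNIV lin_l')
  then show "continuous_on UNIV (inv ?g)"
    unfolding inv_g by (rule smooth_on_imp_continuous_on)
  have "(?g has_derivative l) (at p)" for p
    unfolding g_eq using linear_imp_has_derivative[OF lin_l] by (auto intro!: derivative_eq_intros)
  then have deriv_g: "frechet_derivative ?g (at p) = l" for p
    using frechet_derivative_at by metis
  have Theta_g: "Theta (?g p) (l v) = Theta p v" for p v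
    unfolding Theta_conv_herm rigid_motion_def l_def by (simp add: unitary herm_diff_left)
  show "pseudohermitian_transf ?g"
    unfolding pseudohermitian_transf_def deriv_g
  proof (intro conjI allI impI Theta_g)
    show "diffeo_between UNIV UNIV ?g"
      unfolding diffeo_between_def inv_g using bij smooth_g'
      by (auto simp: g_eq intro!: smooth_on_affine lin_l)
    fix p v :: "'n heis"
    have J: "(\<chi> b. \<i> * z $ b) = \<i> *s z" for z :: "complex ^ 'n" by (simp add: vec_eq_iff)
    \<comment> \<open>Since \<open>Theta\<close> is preserved, the image is horizontal and
      determined by its z-part; there J is multiplication by \<i>, which commutes with
      \<open>H\<close>.\<close>
    have "Theta (?g p) (l (CR_J p v)) = 0" by (simp add: Theta_g CR_J_def)
    then have "l (CR_J p v) = hlift (?g p) (fst (l (CR_J p v)))" by (simp add: hlift_fst_eq)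
    also have "fst (l (CR_J p v)) = \<i> *s fst (l v)" by (simp add: l_def CR_J_def J smult)
    also have "hlift (?g p) \<dots> = CR_J (?g p) (l v)" by (simp add: CR_J_def J)
    finally show "l (CR_J p v) = CR_J (?g p) (l v)" .
  qed
qed

theorem theorem7p1:
  fixes M :: "('n::finite) heis set" and k :: 'n
  assumes "pseudohermitian_submanifold M (CARD('n) - 1)"
    and "vertical M"
    and "simply_connected M"
    and "second_fundamental_form_vanishes M"
  shows "\<exists>g. pseudohermitian_transf g \<and> openin (top_of_set {p. fst p $ k = 0}) (g ` M)"
proof (cases "M = {}")
  case True
  \<comment> \<open>The empty set is open in the hyperplane, so any rigid motion serves.\<close>
  then show ?thesis
    using rigid_motion_pseudohermitian(1)[OF linear_householder householder_smult herm_householder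
        householder_involution] by auto
next
  case False
  then obtain p where p: "p \<in> M" by blast
  obtain W where W: "subspace W" "dim W = 2 * (CARD('n) - 1)" "\<And>w. w \<in> W \<Longrightarrow> \<i> *s w \<in> W"
    and op: "openin (top_of_set {q. fst q - fst p \<in> W}) M"
    using vertical_flat_global_structure[OF assms(1,2,4) simply_connected_imp_connected[OF assms(3)] p]
    unfolding vector_scalar_mult_def by blast
  obtain \<nu> where \<nu>: "\<nu> \<bullet> \<nu> = 1" "\<nu> $ k \<in> \<real>" "W = {w. herm \<nu> w = 0}"
    using complex_hyperplane_normal[OF W] by blast
  let ?Z = "{p :: 'n heis. fst p $ k = 0}"
  let ?e = "axis k 1 :: complex ^ 'n"
  define H where "H = householder (\<nu> - ?e)"
  define g where "g = rigid_motion H (fst p)"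
  note g_props = rigid_motion_pseudohermitian[of H, OF linear_householder[of "\<nu> - ?e", folded H_def]
      householder_smult[of "\<nu> - ?e", folded H_def] herm_householder[of "\<nu> - ?e", folded H_def]
      householder_involution[of "\<nu> - ?e", folded H_def], of "fst p", folded g_def]
  have "herm \<nu> ?e \<in> \<real>"
    using \<nu>(2) cnj_herm[of ?e \<nu>] by (simp add: herm_axis Reals_cnj_iff)
  then have H\<nu>: "H \<nu> = ?e"
    unfolding H_def using \<nu>(1) by (intro householder_swap) (simp_all add: inner_axis_axis)
  \<comment> \<open>The \<open>k\<close>-th entry of \<open>H z\<close> is its product with the
    basis vector \<open>H \<nu>\<close>, which unitarity turns into
    \<open>herm \<nu> z\<close>.\<close>
  have "fst (g q) $ k = herm \<nu> (fst q - fst p)" for q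
    using herm_householder[of "\<nu> - ?e" \<nu> "fst q - fst p", folded H_def]
    by (simp add: H\<nu> herm_axis g_def rigid_motion_def)
  then have A: "g q \<in> ?Z \<longleftrightarrow> q \<in> {q. fst q - fst p \<in> W}" for q
    by (simp add: \<nu>(3))
  have gA: "g ` {q. fst q - fst p \<in> W} = ?Z"
  proof
    show "?Z \<subseteq> g ` {q. fst q - fst p \<in> W}"
    proof
      fix y assume y: "y \<in> ?Z"
      obtain q where "y = g q" using bij_is_surj[OF g_props(2)] by (rule surjE)
      then show "y \<in> g ` {q. fst q - fst p \<in> W}" using A[of q] y by blast
    qed
  qed (use A in blast)
  obtain T where T: "open T" "M = {q. fst q - fst p \<in> W} \<inter> T"
    using op unfolding openin_open by blast
  have "g ` M = ?Z \<inter> g ` T"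
    unfolding T(2) gA[symmetric] by (rule image_Int[OF bij_is_inj[OF g_props(2)]])
  moreover have "open (g ` T)"
    using open_vimage[OF T(1) g_props(3)] bij_vimage_eq_inv_image[OF bij_imp_bij_inv[OF g_props(2)], of T]
      inv_inv_eq[OF g_props(2)] by simp
  ultimately have "openin (top_of_set ?Z) (g ` M)"
    by (simp add: openin_open_Int)
  then show ?thesis using g_props(1) by blast
qed

end
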